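(* Let $G$ be a finite simple graph without isolated vertices, $n=|V(G)|$, and $\varphi=\varphi(G)$. Then $2^{lu(G)}\le obdd(\varphi)\le n^{O(lu(G))}$; that is, $obdd(\varphi)\ge 2^{lu(G)}$, and there is an absolute constant $c>0$ (independent of $G$) such that $obdd(\varphi)\le n^{c\cdot lu(G)}$.
   Context: $\varphi(G)$ is the monotone 2-CNF with variable set $V(G)$ and a clause $(u\vee v)$ for each edge $\{u,v\}\in E(G)$. An OBDD is a directed acyclic graph with one source and two sinks labelled true and false, each non-sink node labelled by a variable and having exactly two outgoing edges labelled $x$ and $\neg x$ where $x$ is its label; no variable appears twice on any directed path, and there is a permutation of the variables such that along every path the node labels appear in the order of this permutation. It represents the function that is true on a total assignment $S$ iff there is a source-to-true-sink path all of whose edge labels belong to $S$. $obdd(\varphi)$ is the minimum number of nodes of an OBDD representing the Boolean function of $\varphi$. For $U\subseteq V(G)$, the upper subgraph $G^U$ is the spanning subgraph of $G$ obtained by deleting all edges with both ends in $V(G)\setminus U$. For sets $U,W$ of vertices of a graph $H$, an induced $(U,W)$-matching of $H$ is a matching of $H$ each edge of which has one end in $U$ and the other in $W$, such that the subgraph of $H$ induced by the endpoints of the matching has no edges other than the matching edges. For a permutation $\pi=(v_1,\dots,v_n)$ of $V(G)$, let $V_i=\{v_1,\dots,v_i\}$, let $r_i$ be the largest size of an induced $(V_i,V(G)\setminus V_i)$-matching of $G^{V_i}$, and $r(\pi)=\max_i r_i$. The linear upper maximum induced matching width $lu(G)$ is the minimum of $r(\pi)$ over all permutations $\pi$ of $V(G)$.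 *)

theory Defs
  imports Complex_Main "HOL-Library.Sublist" "HOL-Combinatorics.Multiset_Permutations"
begin

section \<open>Finite simple graphs\<close>

definition simple_graph :: "'a set \<Rightarrow> 'a set set \<Rightarrow> bool" where
  "simple_graph V E \<longleftrightarrow> finite V \<and> (\<forall>e\<in>E. e \<subseteq> V \<and> card e = 2)"

definition no_isolated :: "'a set \<Rightarrow> 'a set set \<Rightarrow> bool" where
  "no_isolated V E \<longleftrightarrow> (\<forall>v\<in>V. \<exists>e\<in>E. v \<in> e)"


section \<open>Literals, assignments and CNFs\<close>

datatype 'v lit = Pos 'v | Neg 'v

definition total_assignments :: "'v set \<Rightarrow> 'v lit set set" where
  "total_assignments X =
     {S. S \<subseteq> Pos ` X \<union> Neg ` X \<and> (\<forall>x\<in>X. Pos x \<in> S \<longleftrightarrow> Neg x \<notin> S)}"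

text \<open>A clause is a set of literals, a CNF is a set of clauses.\<close>

definition satisfies :: "'v lit set \<Rightarrow> 'v lit set set \<Rightarrow> bool" where
  "satisfies S \<phi> \<longleftrightarrow> (\<forall>C\<in>\<phi>. C \<inter> S \<noteq> {})"

definition graph_cnf :: "'a set set \<Rightarrow> 'a lit set set" where
  "graph_cnf E = {{Pos u, Pos v} | u v. {u, v} \<in> E}"


section \<open>Ordered binary decision diagrams\<close>

text \<open>
  Edges carry their literal, so two edges with the same ends but opposite labels are
  distinct. The value of \<open>label\<close> is irrelevant on sinks.
\<close>

record ('n, 'v) bdd =
  nodes :: "'n set"
  edges :: "('n \<times> 'v lit \<times> 'n) set"
  label :: "'n \<Rightarrow> 'v"
  true_sink :: 'n
  false_sink :: 'n

definition sources :: "('n, 'v) bdd \<Rightarrow> 'n set" where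
  "sources Z = {p \<in> nodes Z. \<not> (\<exists>q l. (q, l, p) \<in> edges Z)}"

definition sinks :: "('n, 'v) bdd \<Rightarrow> 'n set" where
  "sinks Z = {p \<in> nodes Z. \<not> (\<exists>l q. (p, l, q) \<in> edges Z)}"

fun bdd_path :: "('n, 'v) bdd \<Rightarrow> 'n \<Rightarrow> ('n \<times> 'v lit \<times> 'n) list \<Rightarrow> 'n \<Rightarrow> bool" where
  "bdd_path Z p [] q \<longleftrightarrow> p \<in> nodes Z \<and> p = q"
| "bdd_path Z p ((a, l, b) # es) q \<longleftrightarrow> a = p \<and> (a, l, b) \<in> edges Z \<and> bdd_path Z b es q"

text \<open>The variables labelling the non-sink nodes of the path with start \<open>p\<close> and edges \<open>es\<close>.\<close>

definition path_vars :: "('n, 'v) bdd \<Rightarrow> 'n \<Rightarrow> ('n \<times> 'v lit \<times> 'n) list \<Rightarrow> 'v list" where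
  "path_vars Z p es = map (label Z) (filter (\<lambda>r. r \<notin> sinks Z) (p # map (snd \<circ> snd) es))"

definition is_obdd :: "'v set \<Rightarrow> ('n, 'v) bdd \<Rightarrow> bool" where
  "is_obdd X Z \<longleftrightarrow>
     finite (nodes Z) \<and>
     edges Z \<subseteq> nodes Z \<times> UNIV \<times> nodes Z \<and>
     acyclic {(p, q). \<exists>l. (p, l, q) \<in> edges Z} \<and>
     card (sources Z) = 1 \<and>
     true_sink Z \<noteq> false_sink Z \<and>
     sinks Z = {true_sink Z, false_sink Z} \<and>
     (\<forall>p \<in> nodes Z - sinks Z. label Z p \<in> X \<and>
        (\<exists>q\<^sub>1 q\<^sub>0. {(l, q). (p, l, q) \<in> edges Z} = {(Pos (label Z p), q\<^sub>1), (Neg (label Z p), q\<^sub>0)})) \<and>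
     (\<forall>p es q. bdd_path Z p es q \<longrightarrow> distinct (path_vars Z p es)) \<and>
     (\<exists>\<pi> \<in> permutations_of_set X. \<forall>p es q. bdd_path Z p es q \<longrightarrow> subseq (path_vars Z p es) \<pi>)"

definition accepts :: "('n, 'v) bdd \<Rightarrow> 'v lit set \<Rightarrow> bool" where
  "accepts Z S \<longleftrightarrow>
     (\<exists>s\<in>sources Z. \<exists>es. bdd_path Z s es (true_sink Z) \<and> (\<forall>(a, l, b) \<in> set es. l \<in> S))"

definition represents :: "'v set \<Rightarrow> ('n, 'v) bdd \<Rightarrow> 'v lit set set \<Rightarrow> bool" where
  "represents X Z \<phi> \<longleftrightarrow> (\<forall>S \<in> total_assignments X. accepts Z S \<longleftrightarrow> satisfies S \<phi>)"

text \<open>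
  The minimum size of an OBDD for the CNF \<open>\<phi>\<close> over the variables \<open>X\<close>. As OBDDs are finite,
  taking the nodes to be natural numbers is no restriction.
\<close>

definition obdd :: "'v set \<Rightarrow> 'v lit set set \<Rightarrow> nat" where
  "obdd X \<phi> =
     (LEAST s. \<exists>Z :: (nat, 'v) bdd. is_obdd X Z \<and> represents X Z \<phi> \<and> card (nodes Z) = s)"


section \<open>Linear upper maximum induced matching width\<close>

definition upper_edges :: "'a set \<Rightarrow> 'a set set \<Rightarrow> 'a set \<Rightarrow> 'a set set" where
  "upper_edges V E U = E - {e \<in> E. e \<subseteq> V - U}"

definition induced_matching :: "'a set set \<Rightarrow> 'a set \<Rightarrow> 'a set \<Rightarrow> 'a set set \<Rightarrow> bool" where
  "induced_matching E U W M \<longleftrightarrow>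
     M \<subseteq> E \<and> pairwise disjnt M \<and>
     (\<forall>e\<in>M. \<exists>u\<in>U. \<exists>w\<in>W. e = {u, w}) \<and>
     {e \<in> E. e \<subseteq> \<Union>M} = M"

definition cut_width :: "'a set \<Rightarrow> 'a set set \<Rightarrow> 'a set \<Rightarrow> nat" where
  "cut_width V E U = Max {card M | M. induced_matching (upper_edges V E U) U (V - U) M}"

definition perm_width :: "'a set \<Rightarrow> 'a set set \<Rightarrow> 'a list \<Rightarrow> nat" where
  "perm_width V E \<pi> = Max ((\<lambda>i. cut_width V E (set (take i \<pi>))) ` {1..length \<pi>})"

definition lu :: "'a set \<Rightarrow> 'a set set \<Rightarrow> nat" where
  "lu V E = Min (perm_width V E ` permutations_of_set V)"

end

theory Submission imports Defs begin

text \<open>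
  Lower bound: let an OBDD read the variables in the order \<open>\<pi>\<close>, and take an induced matching of
  size \<open>r\<close> across a cut of \<open>\<pi>\<close>. Setting the read ends of the matching edges to all \<open>2 ^ r\<close>
  possible combinations of values, and all other read variables to true, yields pairwise distinct
  subfunctions, so these partial assignments lead to different nodes.

  Upper bound: after \<open>i\<close> variables are read, the subfunction is constantly false or determined by the
  set \<open>T\<close> of unread neighbours of the set \<open>F\<close> of false read vertices. A minimal \<open>F\<close> with a given
  \<open>T\<close> has private neighbours and is independent, hence gives an induced matching of size \<open>card F\<close>.
  So for each \<open>i\<close> the set \<open>T\<close> takes at most \<open>n ^ r + 1\<close> values, and the pairs \<open>(i, T)\<close> are the
  nodes of an OBDD.
\<close>

section \<open>Assignments and paths\<close>

text \<open>An assignment is coded by the set \<open>P\<close> of its true variables; only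
  \<open>X \<inter> P\<close> matters. Taken over a subset of all variables, it is a partial
  assignment.\<close>

definition asg :: "'v set \<Rightarrow> 'v set \<Rightarrow> 'v lit set" where
  "asg X P = Pos ` (X \<inter> P) \<union> Neg ` (X - P)"

lemma Pos_in_asg [simp]: "Pos x \<in> asg X P \<longleftrightarrow> x \<in> X \<and> x \<in> P"
  and Neg_in_asg [simp]: "Neg x \<in> asg X P \<longleftrightarrow> x \<in> X \<and> x \<notin> P"
  by (simp_all add: asg_def image_iff)

lemma asg_subset: "asg X P \<subseteq> Pos ` X \<union> Neg ` X"
  unfolding asg_def by (intro Un_mono image_mono) simp_all

lemma asg_total: "asg X P \<in> total_assignments X"
  by (simp add: total_assignments_def asg_subset)

lemma total_assignments_asg:
  assumes "S \<in> total_assignments X"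
  shows "S = asg X {x. Pos x \<in> S}"
proof (rule set_eqI)
  fix l
  have S: "S \<subseteq> Pos ` X \<union> Neg ` X" "\<And>x. x \<in> X \<Longrightarrow> Pos x \<in> S \<longleftrightarrow> Neg x \<notin> S"
    using assms by (simp_all add: total_assignments_def)
  have "Pos x \<in> S \<Longrightarrow> x \<in> X" "Neg x \<in> S \<Longrightarrow> x \<in> X" for x using S(1) by auto
  then show "l \<in> S \<longleftrightarrow> l \<in> asg X {x. Pos x \<in> S}" using S(2) by (cases l) auto
qed

text \<open>The models of the CNF are the vertex covers of the graph; all later arguments about
  satisfaction are about covers.\<close>

lemma satisfies_asg_graph_cnf:
  assumes "simple_graph V E"
  shows "satisfies (asg V P) (graph_cnf E) \<longleftrightarrow> (\<forall>u v. {u, v} \<in> E \<longrightarrow> u \<in> P \<or> v \<in> P)"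
proof -
  have V: "{u, v} \<in> E \<Longrightarrow> u \<in> V \<and> v \<in> V" for u v
    using assms unfolding simple_graph_def by blast
  have "satisfies (asg V P) (graph_cnf E) \<longleftrightarrow>
      (\<forall>u v. {u, v} \<in> E \<longrightarrow> {Pos u, Pos v} \<inter> asg V P \<noteq> {})"
    unfolding satisfies_def graph_cnf_def by blast
  also have "\<dots> \<longleftrightarrow> (\<forall>u v. {u, v} \<in> E \<longrightarrow> u \<in> P \<or> v \<in> P)"
  proof -
    have "{Pos u, Pos v} \<inter> asg V P \<noteq> {} \<longleftrightarrow> Pos u \<in> asg V P \<or> Pos v \<in> asg V P" for u v :: 'a
      by blast
    then show ?thesis using V by auto
  qed
  finally show ?thesis .
qed

section \<open>Paths consistent with a partial assignment\<close>

lemma bdd_path_append: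
  "bdd_path Z p (es @ fs) q \<longleftrightarrow> (\<exists>r. bdd_path Z p es r \<and> bdd_path Z r fs q)"
  if "edges Z \<subseteq> nodes Z \<times> UNIV \<times> nodes Z"
proof (induction es arbitrary: p)
  case Nil
  have "bdd_path Z p fs q \<Longrightarrow> p \<in> nodes Z"
    using that by (cases fs) auto
  then show ?case by auto
next
  case (Cons e es)
  then show ?case by (cases e) auto
qed

definition reads_in :: "'v lit set \<Rightarrow> ('n \<times> 'v lit \<times> 'n) list \<Rightarrow> bool" where
  "reads_in S es \<longleftrightarrow> (\<forall>(a, l, b) \<in> set es. l \<in> S)"

lemma reads_in_simps [simp]:
  "reads_in S []"
  "reads_in S ((a, l, b) # es) \<longleftrightarrow> l \<in> S \<and> reads_in S es"
  "reads_in S (es @ fs) \<longleftrightarrow> reads_in S es \<and> reads_in S fs"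
  unfolding reads_in_def by (simp_all add: ball_Un)

lemma reads_in_mono: "reads_in S es \<Longrightarrow> S \<subseteq> T \<Longrightarrow> reads_in T es"
  unfolding reads_in_def by fastforce

lemma accepts_reads_in:
  "accepts Z S \<longleftrightarrow> (\<exists>s\<in>sources Z. \<exists>es. bdd_path Z s es (true_sink Z) \<and> reads_in S es)"
  unfolding accepts_def reads_in_def by simp

lemma
  assumes "is_obdd X Z"
  shows is_obdd_finite: "finite (nodes Z)"
    and is_obdd_edges: "edges Z \<subseteq> nodes Z \<times> UNIV \<times> nodes Z"
    and is_obdd_acyclic: "acyclic {(p, q). \<exists>l. (p, l, q) \<in> edges Z}"
    and is_obdd_source: "card (sources Z) = 1"
    and is_obdd_sinks: "sinks Z = {true_sink Z, false_sink Z}"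
  using assms unfolding is_obdd_def by simp_all

lemma is_obdd_out:
  assumes "is_obdd X Z" "p \<in> nodes Z" "p \<notin> sinks Z"
  shows "label Z p \<in> X"
    "\<exists>q1 q0. \<forall>l q. (p, l, q) \<in> edges Z \<longleftrightarrow>
       l = Pos (label Z p) \<and> q = q1 \<or> l = Neg (label Z p) \<and> q = q0"
proof -
  have *: "\<forall>p \<in> nodes Z - sinks Z. label Z p \<in> X \<and>
        (\<exists>q\<^sub>1 q\<^sub>0. {(l, q). (p, l, q) \<in> edges Z} = {(Pos (label Z p), q\<^sub>1), (Neg (label Z p), q\<^sub>0)})"
    using assms(1) unfolding is_obdd_def by (elim conjE)
  then show "label Z p \<in> X" using assms by blast
  from * obtain q1 q0 where
    "{(l, q). (p, l, q) \<in> edges Z} = {(Pos (label Z p), q1), (Neg (label Z p), q0)}"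
    using assms(2,3) by blast
  then have "\<forall>l q. (p, l, q) \<in> edges Z \<longleftrightarrow>
       l = Pos (label Z p) \<and> q = q1 \<or> l = Neg (label Z p) \<and> q = q0"
    unfolding set_eq_iff by simp
  then show "\<exists>q1 q0. \<forall>l q. (p, l, q) \<in> edges Z \<longleftrightarrow>
       l = Pos (label Z p) \<and> q = q1 \<or> l = Neg (label Z p) \<and> q = q0" by blast
qed

lemma is_obdd_edge:
  assumes "is_obdd X Z" "(a, l, b) \<in> edges Z"
  shows "a \<in> nodes Z" "b \<in> nodes Z" "a \<notin> sinks Z" "label Z a \<in> X"
    "l = Pos (label Z a) \<or> l = Neg (label Z a)"
proof -
  show a: "a \<in> nodes Z" "b \<in> nodes Z" using is_obdd_edges[OF assms(1)] assms(2) by auto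
  show s: "a \<notin> sinks Z" using assms(2) unfolding sinks_def by auto
  from is_obdd_out[OF assms(1) a(1) s] assms(2)
  show "label Z a \<in> X" "l = Pos (label Z a) \<or> l = Neg (label Z a)" by blast+
qed

lemma obdd_step_exists:
  assumes "is_obdd X Z" "p \<in> nodes Z" "p \<notin> sinks Z"
  obtains l q where "(p, l, q) \<in> edges Z"
    "l = (if label Z p \<in> P then Pos (label Z p) else Neg (label Z p))"
  using is_obdd_out(2)[OF assms] by metis

text \<open>The two edges leaving \<open>p\<close> carry complementary literals, and
  \<open>asg\<close> never contains both literals of a variable.\<close>

lemma obdd_step_unique:
  assumes "is_obdd X Z" "(p, l, q) \<in> edges Z" "(p, l', q') \<in> edges Z"
    "l \<in> asg Y P" "l' \<in> asg Y P"
  shows "l = l'" "q = q'"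
proof -
  note e = is_obdd_edge[OF assms(1,2)]
  obtain q1 q0 where *: "\<And>l q. (p, l, q) \<in> edges Z \<longleftrightarrow>
       l = Pos (label Z p) \<and> q = q1 \<or> l = Neg (label Z p) \<and> q = q0"
    using is_obdd_out(2)[OF assms(1) e(1,3)] by blast
  show "l = l'" "q = q'" using assms(2-5) unfolding * by auto
qed

text \<open>Runs under the same partial assignment cannot diverge. As \<open>t\<close> is a sink,
  \<open>fs\<close> cannot end while \<open>es\<close> still continues, so \<open>es\<close> is the
  prefix.\<close>

lemma obdd_path_unique:
  assumes "is_obdd X Z" "bdd_path Z p es q" "bdd_path Z p fs t" "t \<in> sinks Z"
    "reads_in (asg Y P) es" "reads_in (asg Y P) fs"
  obtains gs where "fs = es @ gs" "bdd_path Z q gs t"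
  using assms
proof (induction es arbitrary: p fs thesis)
  case (Cons e es)
  obtain a l b where e: "e = (a, l, b)" by (cases e)
  have ed: "(p, l, b) \<in> edges Z" "bdd_path Z b es q" and [simp]: "a = p"
    using Cons.prems(3) e by auto
  have "p \<notin> sinks Z" using is_obdd_edge[OF Cons.prems(2) ed(1)] by simp
  then have "fs \<noteq> []" using Cons.prems(4,5) by auto
  then obtain l' b' fs' where fs: "fs = (p, l', b') # fs'"
    using Cons.prems(4) by (cases fs) auto
  have f: "(p, l', b') \<in> edges Z" "bdd_path Z b' fs' t" using Cons.prems(4) fs by auto
  have eq: "l = l'" "b = b'"
    using obdd_step_unique[OF Cons.prems(2) ed(1) f(1)] Cons.prems(6,7) e fs by auto
  have r: "reads_in (asg Y P) es" "reads_in (asg Y P) fs'" using Cons.prems(6,7) e fs by auto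
  obtain gs where "fs' = es @ gs" "bdd_path Z q gs t"
    by (rule Cons.IH[OF _ Cons.prems(2) ed(2) f(2)[folded eq(2)] Cons.prems(5) r])
  then show ?case using Cons.prems(1) e fs eq by simp
qed auto

text \<open>Follow the literals prescribed by \<open>P\<close> as long as the queried variable lies
  in \<open>U\<close>. Diagrams may skip variables, so the stopping node is characterised by its
  next query and not by the number of variables read.\<close>

lemma obdd_run_exists:
  assumes "is_obdd X Z" "U \<subseteq> X" "s \<in> nodes Z"
  shows "\<exists>es p. bdd_path Z s es p \<and> reads_in (asg U P) es \<and> (p \<in> sinks Z \<or> label Z p \<notin> U)"
proof -
  let ?R = "{(p, q). \<exists>l. (p, l, q) \<in> edges Z}"
  note ac = is_obdd_acyclic[OF assms(1)] and fin = is_obdd_finite[OF assms(1)]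
  have "?R \<subseteq> nodes Z \<times> nodes Z" using is_obdd_edges[OF assms(1)] by auto
  then have "finite ?R" by (rule finite_subset) (simp add: fin)
  \<comment> \<open>A finite acyclic relation is well-founded in the reversed direction too, which
    allows induction from a node to its successors.\<close>
  then have "wf (?R\<inverse>)" using ac by (rule finite_acyclic_wf_converse)
  then show ?thesis using assms(3)
  proof (induction s rule: wf_induct_rule)
    case (less s)
    show ?case
    proof (cases "s \<in> sinks Z \<or> label Z s \<notin> U")
      case True
      then show ?thesis using less.prems by (intro exI[of _ "[]"] exI[of _ s]) simp
    next
      case False
      then have nsink: "s \<notin> sinks Z" by simp
      obtain l q where lq: "(s, l, q) \<in> edges Z"
        "l = (if label Z s \<in> P then Pos (label Z s) else Neg (label Z s))"
        by (rule obdd_step_exists[OF assms(1) less.prems nsink])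
      have "q \<in> nodes Z" using is_obdd_edge[OF assms(1) lq(1)] by simp
      with less.IH lq(1) obtain es p where
        "bdd_path Z q es p" "reads_in (asg U P) es" "p \<in> sinks Z \<or> label Z p \<notin> U"
        by blast
      then show ?thesis using lq False
        by (intro exI[of _ "(s, l, q) # es"] exI[of _ p]) auto
    qed
  qed
qed

section \<open>Queries below a node and the variable order\<close>

lemma subseq_Cons_append_skip:
  "subseq (x # xs) (ys @ zs) \<Longrightarrow> x \<notin> set ys \<Longrightarrow> subseq (x # xs) zs"
  by (induction ys) (auto split: if_splits)

lemma path_vars_Cons:
  "path_vars Z p es = (if p \<in> sinks Z then [] else [label Z p]) @
     map (label Z) (filter (\<lambda>r. r \<notin> sinks Z) (map (snd \<circ> snd) es))"
  unfolding path_vars_def by simp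

lemma path_label_in_path_vars:
  assumes "is_obdd X Z" "bdd_path Z p es q" "(a, l, b) \<in> set es"
  shows "label Z a \<in> set (path_vars Z p es) \<and> (l = Pos (label Z a) \<or> l = Neg (label Z a))
    \<and> label Z a \<in> X"
  using assms(2,3)
proof (induction es arbitrary: p)
  case (Cons e es)
  obtain l' b' where e: "e = (p, l', b')" and ed: "(p, l', b') \<in> edges Z" "bdd_path Z b' es q"
    using Cons.prems(1) by (cases e) auto
  have "set (path_vars Z b' es) \<subseteq> set (path_vars Z p (e # es))"
    unfolding path_vars_def e by auto
  moreover have "label Z p \<in> set (path_vars Z p (e # es))"
    using is_obdd_edge[OF assms(1) ed(1)] unfolding path_vars_def by auto
  ultimately show ?case using Cons e is_obdd_edge[OF assms(1) ed(1)] ed by auto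
qed simp

text \<open>The first variable queried from \<open>p\<close> lies in \<open>drop i \<pi>\<close>,
  and the order \<open>\<pi>\<close> keeps all later queries there. So a path from \<open>p\<close>
  sees only the unread part of the assignment.\<close>

lemma obdd_below_reads:
  assumes obdd: "is_obdd X Z" and dist: "distinct \<pi>" and
    order: "\<And>p es q. bdd_path Z p es q \<Longrightarrow> subseq (path_vars Z p es) \<pi>"
    and p: "p \<in> sinks Z \<or> label Z p \<notin> set (take i \<pi>)"
    and path: "bdd_path Z p es q" and r: "reads_in (asg X Q) es"
  shows "reads_in (asg (X - set (take i \<pi>)) Q) es"
proof (cases es)
  case (Cons e es')
  then have "p \<notin> sinks Z" using path is_obdd_edge(3)[OF obdd] by (cases e) auto
  then obtain xs where xs: "path_vars Z p es = label Z p # xs" and np: "label Z p \<notin> set (take i \<pi>)"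
    using p unfolding path_vars_Cons by auto
  have "subseq (path_vars Z p es) (take i \<pi> @ drop i \<pi>)" using order[OF path] by simp
  then have "subseq (path_vars Z p es) (drop i \<pi>)"
    unfolding xs using np by (rule subseq_Cons_append_skip)
  then have sub: "set (path_vars Z p es) \<subseteq> set (drop i \<pi>)"
    by (auto simp flip: subseq_singleton_left intro: subseq_order.trans)
  have disj: "set (take i \<pi>) \<inter> set (drop i \<pi>) = {}"
    by (rule set_take_disj_set_drop_if_distinct[OF dist order_refl])
  show ?thesis unfolding reads_in_def
  proof (clarify)
    fix a l b assume m: "(a, l, b) \<in> set es"
    have "l \<in> asg X Q" using r m unfolding reads_in_def by auto
    moreover have "label Z a \<notin> set (take i \<pi>)" "l = Pos (label Z a) \<or> l = Neg (label Z a)"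
      using path_label_in_path_vars[OF obdd path m] sub disj by auto
    ultimately show "l \<in> asg (X - set (take i \<pi>)) Q" by auto
  qed
qed simp

lemma asg_cong:
  assumes "X \<inter> P = X \<inter> Q"
  shows "asg X P = asg X Q"
proof -
  have "X - P = X - X \<inter> P" "X - Q = X - X \<inter> Q" by auto
  then show ?thesis unfolding asg_def using assms by simp
qed

lemma asg_mono: "X \<subseteq> Y \<Longrightarrow> asg X P \<subseteq> asg Y P"
  unfolding asg_def by (intro Un_mono image_mono) auto

text \<open>The answer depends on \<open>P\<close> only through the stopping node \<open>p\<close>.
  By determinism an accepting run passes through \<open>p\<close> and below it consults
  \<open>R\<close> alone; conversely a run from \<open>p\<close> extends the path from the
  source.\<close>

lemma obdd_accepts_iff_below:
  assumes obdd: "is_obdd X Z" and dist: "distinct \<pi>" "set \<pi> = X" and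
    order: "\<And>p es q. bdd_path Z p es q \<Longrightarrow> subseq (path_vars Z p es) \<pi>"
    and src: "sources Z = {s}"
    and p: "p \<in> sinks Z \<or> label Z p \<notin> set (take i \<pi>)"
    and path: "bdd_path Z s es p" and r: "reads_in (asg (set (take i \<pi>)) P) es"
    and PR: "P \<subseteq> set (take i \<pi>)" "R \<subseteq> X - set (take i \<pi>)"
  shows "accepts Z (asg X (P \<union> R)) \<longleftrightarrow>
    (\<exists>fs. bdd_path Z p fs (true_sink Z) \<and> reads_in (asg (X - set (take i \<pi>)) R) fs)"
proof -
  let ?U = "set (take i \<pi>)"
  have UX: "?U \<subseteq> X" using dist(2) set_take_subset[of i \<pi>] by simp
  \<comment> \<open>On the read variables \<open>P \<union> R\<close> agrees with \<open>P\<close>,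
    on the unread ones with \<open>R\<close>.\<close>
  have sp: "asg ?U (P \<union> R) = asg ?U P" "asg (X - ?U) (P \<union> R) = asg (X - ?U) R"
    using PR by (auto intro!: asg_cong)
  have r': "reads_in (asg X (P \<union> R)) es"
    by (rule reads_in_mono[OF r]) (use asg_mono[OF UX, of "P \<union> R"] sp in simp)
  show ?thesis
  proof
    assume "accepts Z (asg X (P \<union> R))"
    then obtain fs where fs: "bdd_path Z s fs (true_sink Z)" "reads_in (asg X (P \<union> R)) fs"
      unfolding accepts_reads_in src by auto
    have "true_sink Z \<in> sinks Z" by (simp add: is_obdd_sinks[OF obdd])
    then obtain gs where gs: "fs = es @ gs" "bdd_path Z p gs (true_sink Z)"
      by (rule obdd_path_unique[OF obdd path fs(1) _ r' fs(2)])
    have "reads_in (asg X (P \<union> R)) gs" using fs(2) gs(1) by simp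
    from obdd_below_reads[OF obdd dist(1) order p gs(2) this] gs(2) sp
    show "\<exists>fs. bdd_path Z p fs (true_sink Z) \<and> reads_in (asg (X - ?U) R) fs" by auto
  next
    assume "\<exists>fs. bdd_path Z p fs (true_sink Z) \<and> reads_in (asg (X - ?U) R) fs"
    then obtain fs where fs: "bdd_path Z p fs (true_sink Z)"
      "reads_in (asg (X - ?U) R) fs" by blast
    have "reads_in (asg X (P \<union> R)) fs"
      by (rule reads_in_mono[OF fs(2)]) (use asg_mono[of "X - ?U" X "P \<union> R"] sp in simp)
    moreover have "bdd_path Z s (es @ fs) (true_sink Z)"
      using bdd_path_append[OF is_obdd_edges[OF obdd]] path fs(1) by blast
    ultimately show "accepts Z (asg X (P \<union> R))" unfolding accepts_reads_in src using r' by auto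
  qed
qed

lemma bdd_path_end:
  "edges Z \<subseteq> nodes Z \<times> UNIV \<times> nodes Z \<Longrightarrow> bdd_path Z p es q \<Longrightarrow> q \<in> nodes Z"
  by (induction es arbitrary: p) auto

section \<open>The lower bound\<close>

text \<open>Two members of \<open>\<A>\<close> whose runs stop at the same node would get the same
  answer for every continuation \<open>R\<close>; hence the stopping nodes are pairwise
  distinct.\<close>

lemma obdd_fooling_set:
  assumes obdd: "is_obdd X Z" and rep: "represents X Z \<phi>"
    and dist: "distinct \<pi>" "set \<pi> = X"
    and order: "\<And>p es q. bdd_path Z p es q \<Longrightarrow> subseq (path_vars Z p es) \<pi>"
    and sub: "\<And>A. A \<in> \<A> \<Longrightarrow> P A \<subseteq> set (take i \<pi>)"
    and fool: "\<And>A B. A \<in> \<A> \<Longrightarrow> B \<in> \<A> \<Longrightarrow> A \<noteq> B \<Longrightarrow> \<exists>R \<subseteq> X - set (take i \<pi>).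
       satisfies (asg X (P A \<union> R)) \<phi> \<noteq> satisfies (asg X (P B \<union> R)) \<phi>"
  shows "card \<A> \<le> card (nodes Z)"
proof -
  let ?U = "set (take i \<pi>)"
  have UX: "?U \<subseteq> X" using dist(2) set_take_subset[of i \<pi>] by simp
  note fin = is_obdd_finite[OF obdd]
  obtain s where src: "sources Z = {s}" using is_obdd_source[OF obdd] by (auto simp: card_1_singleton_iff)
  then have s: "s \<in> nodes Z" unfolding sources_def by auto
  \<comment> \<open>\<open>Q A p\<close> says that the run under \<open>P A\<close> on the first
    \<open>i\<close> variables stops at \<open>p\<close>; \<open>h\<close> chooses such a node for
    each \<open>A\<close>.\<close>
  define Q where "Q = (\<lambda>A p. \<exists>es. bdd_path Z s es p \<and> reads_in (asg ?U (P A)) es \<and>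
     (p \<in> sinks Z \<or> label Z p \<notin> ?U))"
  have "\<forall>A. \<exists>p. Q A p" unfolding Q_def using obdd_run_exists[OF obdd UX s] by blast
  then obtain h where h: "\<And>A. Q A (h A)" by metis
  have "inj_on h \<A>"
  proof (rule inj_onI, rule ccontr)
    fix A B assume AB: "A \<in> \<A>" "B \<in> \<A>" "h A = h B" "A \<noteq> B"
    obtain R where R: "R \<subseteq> X - ?U"
      "satisfies (asg X (P A \<union> R)) \<phi> \<noteq> satisfies (asg X (P B \<union> R)) \<phi>"
      using fool[OF AB(1,2,4)] by blast
    have *: "accepts Z (asg X (P C \<union> R)) \<longleftrightarrow>
        (\<exists>fs. bdd_path Z (h C) fs (true_sink Z) \<and> reads_in (asg (X - ?U) R) fs)"
      if "C \<in> \<A>" for C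
    proof -
      obtain es where "bdd_path Z s es (h C)" "reads_in (asg ?U (P C)) es"
        "h C \<in> sinks Z \<or> label Z (h C) \<notin> ?U" using h[of C] unfolding Q_def by blast
      from obdd_accepts_iff_below[OF obdd dist order src this(3,1,2) sub[OF that] R(1)]
      show ?thesis .
    qed
    have "accepts Z (asg X (P A \<union> R)) \<longleftrightarrow> accepts Z (asg X (P B \<union> R))"
      using *[OF AB(1)] *[OF AB(2)] AB(3) by simp
    then show False using R(2) rep asg_total unfolding represents_def by blast
  qed
  moreover have "h ` \<A> \<subseteq> nodes Z"
    using h bdd_path_end[OF is_obdd_edges[OF obdd]] unfolding Q_def by blast
  ultimately show ?thesis using fin by (metis card_inj_on_le)
qed

text \<open>\<open>A\<close> codes the assignment of \<open>U\<close> in which exactly the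
  \<open>U\<close>-ends of the edges in \<open>M - A\<close> are false; the continuation makes false
  only the end of \<open>e\<close> outside \<open>U\<close>. For \<open>B\<close> both ends of
  \<open>e\<close> are then false, whereas for \<open>A\<close> the false vertices span no edge
  because \<open>M\<close> is induced.\<close>

lemma induced_matching_fools:
  assumes G: "simple_graph V E" and U: "U \<subseteq> V"
    and M: "induced_matching (upper_edges V E U) U (V - U) M"
    and A: "A \<subseteq> M" and e: "e \<in> A" "e \<notin> B"
  shows "satisfies (asg V ((U - \<Union>(M - A)) \<union> (V - U - e))) (graph_cnf E)"
    and "\<not> satisfies (asg V ((U - \<Union>(M - B)) \<union> (V - U - e))) (graph_cnf E)"
proof -
  have EV: "\<And>u v. {u, v} \<in> E \<Longrightarrow> u \<in> V \<and> v \<in> V \<and> u \<noteq> v"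
    using G unfolding simple_graph_def by fastforce
  have ME: "M \<subseteq> E" and ind: "\<And>f. f \<in> upper_edges V E U \<Longrightarrow> f \<subseteq> \<Union>M \<Longrightarrow> f \<in> M"
    and bip: "\<And>f. f \<in> M \<Longrightarrow> \<exists>u\<in>U. \<exists>w\<in>V - U. f = {u, w}"
    and disj: "\<And>f g x. f \<in> M \<Longrightarrow> g \<in> M \<Longrightarrow> x \<in> f \<Longrightarrow> x \<in> g \<Longrightarrow> f = g"
  proof -
    show "M \<subseteq> E" using M unfolding induced_matching_def upper_edges_def by blast
    show "f \<in> upper_edges V E U \<Longrightarrow> f \<subseteq> \<Union>M \<Longrightarrow> f \<in> M" for f
      using M unfolding induced_matching_def by blast
    show "f \<in> M \<Longrightarrow> \<exists>u\<in>U. \<exists>w\<in>V - U. f = {u, w}" for f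
      using M unfolding induced_matching_def by simp
    show "f \<in> M \<Longrightarrow> g \<in> M \<Longrightarrow> x \<in> f \<Longrightarrow> x \<in> g \<Longrightarrow> f = g" for f g x
      using M unfolding induced_matching_def pairwise_def disjnt_iff by blast
  qed
  have eM: "e \<in> M" using e A by blast
  obtain u w where uw: "u \<in> U" "w \<in> V - U" "e = {u, w}" using bip[OF eM] by blast
  have up: "x \<in> U \<or> y \<in> U \<Longrightarrow> {x, y} \<in> E \<Longrightarrow> {x, y} \<in> upper_edges V E U" for x y
    unfolding upper_edges_def by blast
  \<comment> \<open>An uncovered edge with an end in \<open>U\<close> survives in the upper subgraph
    and lies inside \<open>\<Union>M\<close>, so it belongs to \<open>M\<close>. Its other end is
    outside \<open>U\<close>, hence in \<open>e\<close>, so the edge is \<open>e\<close> itself; but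
    \<open>e \<in> A\<close> is disjoint from all edges of \<open>M - A\<close>.\<close>
  have key: False if xy: "{x, y} \<in> E" "x \<in> U" "x \<in> \<Union>(M - A)" "y \<in> V"
    "y \<in> U \<Longrightarrow> y \<in> \<Union>(M - A)" "y \<notin> U \<Longrightarrow> y \<in> e" for x y
  proof -
    have "{x, y} \<subseteq> \<Union>M" using xy eM by blast
    then have m: "{x, y} \<in> M" using ind up xy by blast
    from bip[OF m] xy(2) have "y \<notin> U" by (auto simp: doubleton_eq_iff)
    then have "{x, y} = e" using xy disj[OF m eM, of y] by blast
    then show False using xy(3) disj[of e _ x] eM e by blast
  qed
  show "satisfies (asg V ((U - \<Union>(M - A)) \<union> (V - U - e))) (graph_cnf E)"
    unfolding satisfies_asg_graph_cnf[OF G]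
  proof (intro allI impI, rule ccontr)
    fix x y assume xy: "{x, y} \<in> E" and
      n: "\<not> (x \<in> (U - \<Union>(M - A)) \<union> (V - U - e) \<or> y \<in> (U - \<Union>(M - A)) \<union> (V - U - e))"
    have V: "x \<in> V" "y \<in> V" "x \<noteq> y" using EV[OF xy] by auto
    consider "x \<in> U" | "y \<in> U" | "x \<notin> U" "y \<notin> U" by blast
    then show False
    proof cases
      case 1 then show ?thesis using key[OF xy] n V by blast
    next
      case 2
      have "{y, x} \<in> E" using xy by (simp add: insert_commute)
      then show ?thesis using key[of y x] 2 n V by blast
    next
      \<comment> \<open>Outside \<open>U\<close> the only false vertex is \<open>w\<close>. So the
        edges deleted from the upper subgraph cannot be violated either.\<close>
      case 3 then show ?thesis using n V uw by blast
    qed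
  qed
  show "\<not> satisfies (asg V ((U - \<Union>(M - B)) \<union> (V - U - e))) (graph_cnf E)"
  proof -
    have "{u, w} \<in> E" "u \<in> \<Union>(M - B)" using uw eM ME e by auto
    then show ?thesis unfolding satisfies_asg_graph_cnf[OF G] using uw by blast
  qed
qed

text \<open>The fooling set is \<open>Pow M\<close>: each subset selects the matching edges whose
  \<open>U\<close>-ends stay true.\<close>

lemma induced_matching_lower_bound:
  assumes G: "simple_graph V E" and obdd: "is_obdd V Z" and rep: "represents V Z (graph_cnf E)"
    and dist: "distinct \<pi>" "set \<pi> = V"
    and order: "\<And>p es q. bdd_path Z p es q \<Longrightarrow> subseq (path_vars Z p es) \<pi>"
    and M: "induced_matching (upper_edges V E (set (take i \<pi>))) (set (take i \<pi>)) (V - set (take i \<pi>)) M"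
  shows "2 ^ card M \<le> card (nodes Z)"
proof -
  let ?U = "set (take i \<pi>)"
  have UV: "?U \<subseteq> V" using dist(2) set_take_subset[of i \<pi>] by simp
  have "M \<subseteq> Pow V" using M G unfolding induced_matching_def upper_edges_def simple_graph_def by blast
  then have fin: "finite M" using G finite_subset unfolding simple_graph_def by blast
  have "card (Pow M) \<le> card (nodes Z)"
  proof (rule obdd_fooling_set[OF obdd rep dist order, where P = "\<lambda>A. ?U - \<Union>(M - A)" and i = i])
    fix A B assume AB: "A \<in> Pow M" "B \<in> Pow M" "A \<noteq> B"
    \<comment> \<open>An edge in the symmetric difference separates \<open>A\<close> from
      \<open>B\<close>; which of the two assignments gets satisfied depends on the side where
      \<open>e\<close> lies.\<close>
    then obtain e where "e \<in> A \<and> e \<notin> B \<or> e \<in> B \<and> e \<notin> A" by blast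
    then show "\<exists>R \<subseteq> V - ?U. satisfies (asg V (?U - \<Union>(M - A) \<union> R)) (graph_cnf E) \<noteq>
      satisfies (asg V (?U - \<Union>(M - B) \<union> R)) (graph_cnf E)"
      using induced_matching_fools[OF G UV M, of A e B] induced_matching_fools[OF G UV M, of B e A] AB
      by (intro exI[of _ "V - ?U - e"]) blast
  qed auto
  then show ?thesis using fin by (simp add: card_Pow)
qed

section \<open>Attainment of the extrema defining the widths\<close>

lemma cut_width_set:
  assumes "simple_graph V E"
  shows "finite {card M | M. induced_matching (upper_edges V E U) U W M}" (is "finite ?S")
    and "{card M | M. induced_matching (upper_edges V E U) U W M} \<noteq> {}"
proof -
  have "E \<subseteq> Pow V" "finite V" using assms unfolding simple_graph_def by blast+
  then have "finite E" using finite_subset by blast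
  moreover have "induced_matching (upper_edges V E U) U W M \<Longrightarrow> M \<in> Pow E" for M
    unfolding induced_matching_def upper_edges_def by simp blast
  then have "?S \<subseteq> card ` Pow E" by blast
  ultimately show "finite ?S" using finite_subset by blast
  \<comment> \<open>This makes the empty matching induced: the empty set would be the only possible
    edge inside its union.\<close>
  have "{} \<notin> E" using assms unfolding simple_graph_def by force
  then have "induced_matching (upper_edges V E U) U W {}"
    unfolding induced_matching_def upper_edges_def by (auto simp: pairwise_def)
  then show "?S \<noteq> {}" by blast
qed

lemma cut_width_attained:
  assumes "simple_graph V E"
  obtains M where "induced_matching (upper_edges V E U) U (V - U) M" "card M = cut_width V E U"
proof -
  have "cut_width V E U \<in> {card M | M. induced_matching (upper_edges V E U) U (V - U) M}"
    unfolding cut_width_def by (rule Max_in[OF cut_width_set[OF assms]])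
  then show ?thesis using that by auto
qed

lemma card_le_cut_width:
  assumes "simple_graph V E" "induced_matching (upper_edges V E U) U (V - U) M"
  shows "card M \<le> cut_width V E U"
  unfolding cut_width_def by (rule Max_ge[OF cut_width_set(1)[OF assms(1)]]) (use assms in blast)

lemma lu_le_perm_width:
  assumes "finite V" "distinct \<pi>" "set \<pi> = V"
  shows "lu V E \<le> perm_width V E \<pi>"
  unfolding lu_def by (rule Min_le) (use assms in \<open>simp_all add: permutations_of_setI\<close>)

lemma lu_attained:
  assumes "finite V"
  obtains \<pi> where "distinct \<pi>" "set \<pi> = V" "perm_width V E \<pi> = lu V E"
proof -
  have "lu V E \<in> perm_width V E ` permutations_of_set V"
    unfolding lu_def by (rule Min_in) (use assms in auto)
  then show ?thesis using that by (auto simp: permutations_of_set_def)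
qed

text \<open>Any OBDD comes with a variable order of its own, and some cut of that order carries an
  induced matching of size at least \<open>lu V E\<close>.\<close>

lemma obdd_size_lower_bound:
  assumes G: "simple_graph V E" "V \<noteq> {}" and obdd: "is_obdd V Z"
    and rep: "represents V Z (graph_cnf E)"
  shows "2 ^ lu V E \<le> card (nodes Z)"
proof -
  have "\<exists>\<pi> \<in> permutations_of_set V. \<forall>p es q. bdd_path Z p es q \<longrightarrow> subseq (path_vars Z p es) \<pi>"
    using obdd unfolding is_obdd_def by (elim conjE)
  then obtain \<pi> where \<pi>: "distinct \<pi>" "set \<pi> = V"
    and order: "\<And>p es q. bdd_path Z p es q \<Longrightarrow> subseq (path_vars Z p es) \<pi>"
    unfolding permutations_of_set_def by blast
  \<comment> \<open>Cuts are indexed from 1, so a nonempty \<open>V\<close> is what makes the set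
    under \<open>Max\<close> nonempty.\<close>
  have "length \<pi> \<ge> 1" using \<pi>(2) G(2) by (cases \<pi>) auto
  then have "perm_width V E \<pi> \<in> (\<lambda>i. cut_width V E (set (take i \<pi>))) ` {1..length \<pi>}"
    unfolding perm_width_def by (intro Max_in) auto
  then obtain i where i: "perm_width V E \<pi> = cut_width V E (set (take i \<pi>))" by blast
  obtain M where M: "induced_matching (upper_edges V E (set (take i \<pi>))) (set (take i \<pi>)) (V - set (take i \<pi>)) M"
    "card M = cut_width V E (set (take i \<pi>))" by (rule cut_width_attained[OF G(1)])
  have "finite V" using G(1) unfolding simple_graph_def by simp
  then have "lu V E \<le> card M" using lu_le_perm_width[OF _ \<pi>, of E] i M(2) by simp
  then have "(2::nat) ^ lu V E \<le> 2 ^ card M" by simp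
  also have "\<dots> \<le> card (nodes Z)"
    by (rule induced_matching_lower_bound[OF G(1) obdd rep \<pi> order M(1)])
  finally show ?thesis .
qed

section \<open>OBDDs from levelled nodes, and renaming of nodes\<close>

text \<open>Levels that increase along edges and determine the label by position in
  \<open>\<pi>\<close> yield acyclicity, the common order and the absence of repeated variables
  together.\<close>

lemma is_obdd_by_level:
  assumes fin: "finite (nodes Z)" and ed: "edges Z \<subseteq> nodes Z \<times> UNIV \<times> nodes Z"
    and "card (sources Z) = 1" "true_sink Z \<noteq> false_sink Z" "sinks Z = {true_sink Z, false_sink Z}"
    and out: "\<And>p. p \<in> nodes Z - sinks Z \<Longrightarrow> \<exists>q1 q0.
       {(l, q). (p, l, q) \<in> edges Z} = {(Pos (label Z p), q1), (Neg (label Z p), q0)}"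
    and \<pi>: "distinct \<pi>" "set \<pi> = X"
    and lev: "\<And>p l q. (p, l, q) \<in> edges Z \<Longrightarrow>
       lev p < lev q \<and> lev p < length \<pi> \<and> label Z p = \<pi> ! lev p"
  shows "is_obdd X Z"
proof -
  have ns: "\<exists>l q. (p, l, q) \<in> edges Z" if "p \<in> nodes Z" "p \<notin> sinks Z" for p
    using that unfolding sinks_def by simp
  \<comment> \<open>The induction needs the sharper claim that a path from \<open>p\<close> queries
    only positions from \<open>lev p\<close> on.\<close>
  have sub: "subseq (path_vars Z p es) (drop (lev p) \<pi>)" if "bdd_path Z p es q" for p es q
    using that
  proof (induction es arbitrary: p)
    case Nil
    show ?case
    proof (cases "p \<in> sinks Z")
      case False
      \<comment> \<open>A non-sink has an outgoing edge, and \<open>lev\<close> speaks about labels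
        only at starts of edges.\<close>
      then obtain l q where "(p, l, q) \<in> edges Z" using ns[of p] Nil by auto
      from lev[OF this] have "drop (lev p) \<pi> = label Z p # drop (Suc (lev p)) \<pi>"
        by (simp add: Cons_nth_drop_Suc)
      then show ?thesis using False by (simp add: path_vars_def)
    qed (simp add: path_vars_def)
  next
    case (Cons e es)
    obtain l b where e: "e = (p, l, b)" and pe: "(p, l, b) \<in> edges Z" "bdd_path Z b es q"
      using Cons.prems by (cases e) auto
    have "p \<notin> sinks Z" using pe(1) unfolding sinks_def by auto
    then have eq: "path_vars Z p (e # es) = label Z p # path_vars Z b es"
      by (simp add: path_vars_def e)
    note l = lev[OF pe(1)]
    \<comment> \<open>An edge may jump over several levels, so what remains at \<open>b\<close> is
      only some suffix of what follows position \<open>lev p\<close>.\<close>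
    have "drop (lev b) \<pi> = drop (lev b - Suc (lev p)) (drop (Suc (lev p)) \<pi>)" using l by simp
    then have "subseq (drop (lev b) \<pi>) (drop (Suc (lev p)) \<pi>)"
      by (metis suffix_drop suffix_imp_subseq)
    then have "subseq (path_vars Z b es) (drop (Suc (lev p)) \<pi>)"
      using Cons.IH[OF pe(2)] subseq_order.trans by blast
    moreover have "drop (lev p) \<pi> = label Z p # drop (Suc (lev p)) \<pi>"
      using l by (simp add: Cons_nth_drop_Suc)
    ultimately show ?case unfolding eq by simp
  qed
  have sub': "subseq (path_vars Z p es) \<pi>" if "bdd_path Z p es q" for p es q
    using sub[OF that] suffix_imp_subseq[OF suffix_drop] subseq_order.trans by blast
  have "{(p, q). \<exists>l. (p, l, q) \<in> edges Z} \<subseteq> measure lev" using lev by auto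
  then have "acyclic {(p, q). \<exists>l. (p, l, q) \<in> edges Z}"
    using wf_acyclic wf_subset wf_measure by blast
  moreover have "label Z p \<in> X" if "p \<in> nodes Z - sinks Z" for p
    using ns[of p] that lev \<pi>(2) nth_mem by fastforce
  moreover have "\<forall>p es q. bdd_path Z p es q \<longrightarrow> distinct (path_vars Z p es)"
    using sub' \<pi>(1) subseqs_distinctD in_set_subseqs by blast
  moreover have "\<exists>\<pi> \<in> permutations_of_set X. \<forall>p es q. bdd_path Z p es q \<longrightarrow> subseq (path_vars Z p es) \<pi>"
    using sub' permutations_of_setI[OF \<pi>(2,1)] by blast
  ultimately show ?thesis unfolding is_obdd_def using assms(1-5) out by simp
qed

text \<open>Serves to replace arbitrary nodes by natural numbers, since \<open>obdd\<close> ranges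
  over diagrams on \<open>nat\<close> only.\<close>

definition rename_bdd :: "('m \<Rightarrow> 'n) \<Rightarrow> ('m, 'v) bdd \<Rightarrow> ('n, 'v) bdd" where
  "rename_bdd f Z = \<lparr>nodes = f ` nodes Z,
     edges = (\<lambda>(p, l, q). (f p, l, f q)) ` edges Z,
     label = label Z \<circ> inv_into (nodes Z) f,
     true_sink = f (true_sink Z), false_sink = f (false_sink Z)\<rparr>"

context
  fixes f :: "'m \<Rightarrow> 'n" and Z :: "('m, 'v) bdd" and X :: "'v set" and Y
  assumes obdd: "is_obdd X Z" and inj: "inj_on f (nodes Z)" and Y: "Y = rename_bdd f Z"
begin

lemma rename_bdd_simps:
  "nodes Y = f ` nodes Z" "true_sink Y = f (true_sink Z)" "false_sink Y = f (false_sink Z)"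
  "p \<in> nodes Z \<Longrightarrow> label Y (f p) = label Z p"
  by (simp_all add: Y rename_bdd_def inj)

lemma rename_bdd_edges_iff:
  "(p', l, q') \<in> edges Y \<longleftrightarrow> (\<exists>p q. p' = f p \<and> q' = f q \<and> (p, l, q) \<in> edges Z)"
  unfolding Y rename_bdd_def by force

lemma rename_bdd_edge:
  "p \<in> nodes Z \<Longrightarrow> (f p, l, q') \<in> edges Y \<longleftrightarrow> (\<exists>q. q' = f q \<and> (p, l, q) \<in> edges Z)"
  "p \<in> nodes Z \<Longrightarrow> (q', l, f p) \<in> edges Y \<longleftrightarrow> (\<exists>q. q' = f q \<and> (q, l, p) \<in> edges Z)"
  unfolding rename_bdd_edges_iff using is_obdd_edge(1,2)[OF obdd] inj
  by (metis inj_on_eq_iff)+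

lemma rename_bdd_sinks: "p \<in> nodes Z \<Longrightarrow> f p \<in> sinks Y \<longleftrightarrow> p \<in> sinks Z" "sinks Y = f ` sinks Z"
proof -
  show *: "p \<in> nodes Z \<Longrightarrow> f p \<in> sinks Y \<longleftrightarrow> p \<in> sinks Z" for p
    unfolding sinks_def rename_bdd_simps(1) by (auto simp: rename_bdd_edge)
  have "sinks Y \<subseteq> f ` nodes Z" "sinks Z \<subseteq> nodes Z" unfolding sinks_def rename_bdd_simps by auto
  then show "sinks Y = f ` sinks Z" using * by blast
qed

lemma rename_bdd_sources: "sources Y = f ` sources Z"
proof -
  have *: "p \<in> nodes Z \<Longrightarrow> f p \<in> sources Y \<longleftrightarrow> p \<in> sources Z" for p
    unfolding sources_def rename_bdd_simps(1) by (auto simp: rename_bdd_edge)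
  have "sources Y \<subseteq> f ` nodes Z" "sources Z \<subseteq> nodes Z" unfolding sources_def rename_bdd_simps by auto
  then show "sources Y = f ` sources Z" using * by blast
qed

text \<open>Paths of the copy lift to the original with the same queried variables; this transfers
  the order condition, and from it distinctness.\<close>

lemma rename_bdd_path:
  assumes "bdd_path Y (f p) es' q'" "p \<in> nodes Z"
  obtains es q where "bdd_path Z p es q" "q' = f q"
    "es' = map (\<lambda>(a, l, b). (f a, l, f b)) es" "path_vars Y (f p) es' = path_vars Z p es"
  using assms
proof (induction es' arbitrary: p thesis)
  case Nil
  have "q' = f p" using Nil(2) by simp
  moreover have "path_vars Y (f p) [] = path_vars Z p []"
    using Nil(3) by (simp add: path_vars_def rename_bdd_simps(4) rename_bdd_sinks(1))
  ultimately show ?case using Nil(1)[of "[]" p] Nil(3) by simp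
next
  case (Cons e es')
  obtain l b' where e: "e = (f p, l, b')" and ed: "(f p, l, b') \<in> edges Y" "bdd_path Y b' es' q'"
    using Cons.prems(2) by (cases e) auto
  obtain b where b: "b' = f b" "(p, l, b) \<in> edges Z"
    using ed(1) rename_bdd_edge(1)[OF Cons.prems(3)] by blast
  have bn: "b \<in> nodes Z" using is_obdd_edge(2)[OF obdd b(2)] .
  obtain es q where IH: "bdd_path Z b es q" "q' = f q"
    "es' = map (\<lambda>(a, l, b). (f a, l, f b)) es" "path_vars Y (f b) es' = path_vars Z b es"
    by (rule Cons.IH[OF _ ed(2)[unfolded b(1)] bn])
  have "p \<notin> sinks Z" using is_obdd_edge(3)[OF obdd b(2)] .
  then show ?case
    using Cons.prems(3) b IH e
    by (intro Cons.prems(1)[of "(p, l, b) # es" q])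
      (auto simp: path_vars_def rename_bdd_simps rename_bdd_sinks(1))
qed

lemma rename_bdd_path': "bdd_path Z p es q \<Longrightarrow> bdd_path Y (f p) (map (\<lambda>(a, l, b). (f a, l, f b)) es) (f q)"
proof (induction es arbitrary: p)
  case Nil
  then show ?case by (auto simp: rename_bdd_simps)
next
  case (Cons e es)
  obtain l b where e: "e = (p, l, b)" and ed: "(p, l, b) \<in> edges Z" "bdd_path Z b es q"
    using Cons.prems by (cases e) auto
  have "(f p, l, f b) \<in> edges Y" using ed(1) unfolding rename_bdd_edges_iff by blast
  then show ?case using Cons.IH[OF ed(2)] e by simp
qed

lemma is_obdd_rename: "is_obdd X Y"
proof -
  obtain \<pi> where \<pi>: "\<pi> \<in> permutations_of_set X"
    "\<And>p es q. bdd_path Z p es q \<Longrightarrow> subseq (path_vars Z p es) \<pi>"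
    using obdd unfolding is_obdd_def by blast
  have sub: "subseq (path_vars Y p' es) \<pi>" if "bdd_path Y p' es q'" for p' es q'
  proof -
    have Yed: "edges Y \<subseteq> nodes Y \<times> UNIV \<times> nodes Y"
      using is_obdd_edges[OF obdd] unfolding Y rename_bdd_def by auto
    have "p' \<in> nodes Y" using that Yed by (cases es) auto
    then obtain p where p: "p' = f p" "p \<in> nodes Z" unfolding rename_bdd_simps by blast
    show ?thesis
      by (rule rename_bdd_path[OF that[unfolded p(1)] p(2)]) (use \<pi>(2) p(1) in simp)
  qed
  have dist: "distinct (path_vars Y p' es)" if "bdd_path Y p' es q'" for p' es q'
    using sub[OF that] \<pi>(1) subseqs_distinctD in_set_subseqs unfolding permutations_of_set_def by blast
  have wfZ: "wf ({(p, q). \<exists>l. (p, l, q) \<in> edges Z}\<inverse>)"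
  proof (rule finite_acyclic_wf_converse)
    have "{(p, q). \<exists>l. (p, l, q) \<in> edges Z} \<subseteq> nodes Z \<times> nodes Z"
      using is_obdd_edges[OF obdd] by auto
    then show "finite {(p, q). \<exists>l. (p, l, q) \<in> edges Z}"
      by (rule finite_subset) (simp add: is_obdd_finite[OF obdd])
  qed (rule is_obdd_acyclic[OF obdd])
  have ac: "acyclic {(p, q). \<exists>l. (p, l, q) \<in> edges Y}"
  proof -
    let ?g = "inv_into (nodes Z) f"
    \<comment> \<open>The inverse of \<open>f\<close> sends edges of the copy to edges of the
      original, so well-foundedness is inherited through an inverse image.\<close>
    have "{(p, q). \<exists>l. (p, l, q) \<in> edges Y}\<inverse> \<subseteq> inv_image ({(p, q). \<exists>l. (p, l, q) \<in> edges Z}\<inverse>) ?g"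
    proof (clarify)
      fix p' q' l assume "(p', l, q') \<in> edges Y"
      then obtain p q where "p' = f p" "q' = f q" and pq: "(p, l, q) \<in> edges Z"
        unfolding rename_bdd_edges_iff by blast
      then have "?g p' = p" "?g q' = q" using is_obdd_edge(1,2)[OF obdd pq] inj by simp_all
      then show "(q', p') \<in> inv_image ({(p, q). \<exists>l. (p, l, q) \<in> edges Z}\<inverse>) ?g" using pq by auto
    qed
    then have "wf ({(p, q). \<exists>l. (p, l, q) \<in> edges Y}\<inverse>)"
      by (rule wf_subset[OF wf_inv_image[OF wfZ]])
    from wf_acyclic[OF this] show ?thesis by (simp only: acyclic_converse)
  qed
  have src: "card (sources Y) = 1"
  proof -
    have "sources Z \<subseteq> nodes Z" unfolding sources_def by auto
    then show ?thesis
      unfolding rename_bdd_sources using is_obdd_source[OF obdd] inj by (metis card_image inj_on_subset)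
  qed
  have snk: "sinks Y = {true_sink Y, false_sink Y}"
    unfolding rename_bdd_sinks rename_bdd_simps is_obdd_sinks[OF obdd] by simp
  have tf: "true_sink Y \<noteq> false_sink Y"
  proof -
    have "true_sink Z \<noteq> false_sink Z" using obdd unfolding is_obdd_def by simp
    moreover have "{true_sink Z, false_sink Z} \<subseteq> nodes Z"
      unfolding is_obdd_sinks[OF obdd, symmetric] sinks_def by auto
    ultimately show ?thesis unfolding rename_bdd_simps using inj by (auto simp: inj_on_eq_iff)
  qed
  have out: "label Y p' \<in> X \<and> (\<exists>q1 q0. {(l, q). (p', l, q) \<in> edges Y} =
      {(Pos (label Y p'), q1), (Neg (label Y p'), q0)})" if p': "p' \<in> nodes Y - sinks Y" for p'
  proof -
    obtain p where p: "p' = f p" "p \<in> nodes Z"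
      using p' unfolding rename_bdd_simps(1) by blast
    then have "p \<notin> sinks Z" using p' rename_bdd_sinks(1)[of p] by simp
    note p = p this
    obtain q1 q0 where *: "\<And>l q. (p, l, q) \<in> edges Z \<longleftrightarrow>
       l = Pos (label Z p) \<and> q = q1 \<or> l = Neg (label Z p) \<and> q = q0"
      using is_obdd_out(2)[OF obdd p(2,3)] by blast
    have "{(l, q). (p', l, q) \<in> edges Y} = {(Pos (label Y p'), f q1), (Neg (label Y p'), f q0)}"
      using p by (auto simp: rename_bdd_edge * rename_bdd_simps)
    then show ?thesis using is_obdd_out(1)[OF obdd p(2,3)] p by (auto simp: rename_bdd_simps)
  qed
  have ne: "finite (nodes Y)" "edges Y \<subseteq> nodes Y \<times> UNIV \<times> nodes Y"
    using is_obdd_finite[OF obdd] is_obdd_edges[OF obdd] unfolding Y rename_bdd_def by auto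
  show ?thesis unfolding is_obdd_def
    using ne ac src tf snk out dist sub \<pi>(1) by blast
qed

lemma accepts_rename: "accepts Y S \<longleftrightarrow> accepts Z S"
proof
  assume "accepts Y S"
  then obtain s es where s: "s \<in> sources Z" "bdd_path Y (f s) es (f (true_sink Z))" "reads_in S es"
    unfolding accepts_reads_in rename_bdd_sources rename_bdd_simps by blast
  have sn: "s \<in> nodes Z" using s(1) unfolding sources_def by auto
  obtain fs q where fs: "bdd_path Z s fs q" "f (true_sink Z) = f q"
    "es = map (\<lambda>(a, l, b). (f a, l, f b)) fs"
    by (rule rename_bdd_path[OF s(2) sn])
  have "q \<in> nodes Z" using bdd_path_end[OF is_obdd_edges[OF obdd] fs(1)] .
  moreover have "true_sink Z \<in> nodes Z" using is_obdd_sinks[OF obdd] unfolding sinks_def by blast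
  ultimately have "q = true_sink Z" using fs(2) inj by (simp add: inj_on_eq_iff)
  moreover have "reads_in S fs" using s(3) unfolding fs(3) reads_in_def by fastforce
  ultimately show "accepts Z S" unfolding accepts_reads_in using fs(1) s(1) by blast
next
  assume "accepts Z S"
  then obtain s es where s: "s \<in> sources Z" "bdd_path Z s es (true_sink Z)" "reads_in S es"
    unfolding accepts_reads_in by blast
  have "reads_in S (map (\<lambda>(a, l, b). (f a, l, f b)) es)"
    using s(3) unfolding reads_in_def by fastforce
  then show "accepts Y S"
    unfolding accepts_reads_in rename_bdd_sources rename_bdd_simps
    using rename_bdd_path'[OF s(2)] s(1) by blast
qed

end

section \<open>Attainment of the minimum OBDD size\<close>

lemma obdd_on_nat:
  fixes Z :: "('n, 'v) bdd"
  assumes "is_obdd X Z" "represents X Z \<phi>"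
  obtains Y :: "(nat, 'v) bdd"
  where "is_obdd X Y" "represents X Y \<phi>" "card (nodes Y) = card (nodes Z)"
proof -
  obtain f :: "'n \<Rightarrow> nat" where f: "inj_on f (nodes Z)"
    using finite_imp_inj_to_nat_seg[OF is_obdd_finite[OF assms(1)]] by blast
  show ?thesis
    using that[OF is_obdd_rename[OF assms(1) f refl]] assms(2) accepts_rename[OF assms(1) f refl]
    by (simp add: represents_def rename_bdd_def card_image f)
qed

lemma obdd_le:
  assumes "is_obdd X Z" "represents X Z \<phi>"
  shows "obdd X \<phi> \<le> card (nodes Z)"
  by (rule obdd_on_nat[OF assms]) (auto simp: obdd_def intro!: Least_le)

text \<open>One OBDD on any node type suffices for the \<open>LEAST\<close> in \<open>obdd\<close>
  to have a witness.\<close>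

lemma obdd_attained:
  assumes "is_obdd X Z" "represents X Z \<phi>"
  obtains Y :: "(nat, 'v) bdd"
  where "is_obdd X Y" "represents X Y \<phi>" "card (nodes Y) = obdd X \<phi>"
proof -
  let ?P = "\<lambda>s. \<exists>Z :: (nat, 'v) bdd. is_obdd X Z \<and> represents X Z \<phi> \<and> card (nodes Z) = s"
  have "?P (card (nodes Z))" using obdd_on_nat[OF assms] by metis
  then have "?P (obdd X \<phi>)" unfolding obdd_def by (rule LeastI)
  then show ?thesis using that by blast
qed

section \<open>The upper bound\<close>

definition nbhd :: "'a set set \<Rightarrow> 'a set \<Rightarrow> 'a set" where
  "nbhd E F = {w. \<exists>u\<in>F. {u, w} \<in> E}"

definition indep :: "'a set set \<Rightarrow> 'a set \<Rightarrow> bool" where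
  "indep E F \<longleftrightarrow> (\<forall>u\<in>F. \<forall>v\<in>F. {u, v} \<notin> E)"

lemma simple_graph_edge:
  assumes "simple_graph V E" "{u, v} \<in> E"
  shows "u \<in> V" "v \<in> V" "u \<noteq> v"
  using assms unfolding simple_graph_def by fastforce+

lemma simple_graph_edge_cases:
  assumes "simple_graph V E" "e \<in> E"
  obtains u v where "e = {u, v}"
  using assms unfolding simple_graph_def card_2_iff by metis

text \<open>In a smallest \<open>F'\<close> with the same trace every vertex has a private neighbour
  outside \<open>U\<close>. These pairs form an induced matching of the upper subgraph:
  \<open>F'\<close> is independent, cross edges respect privacy, and edges among the private
  neighbours are deleted.\<close>

lemma small_set_same_trace:
  assumes G: "simple_graph V E" and U: "U \<subseteq> V" and F: "F \<subseteq> U" "indep E F"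
  obtains F' where "F' \<subseteq> F" "nbhd E F' \<inter> (V - U) = nbhd E F \<inter> (V - U)" "card F' \<le> cut_width V E U"
proof -
  let ?D = "V - U"
  let ?P = "\<lambda>H. H \<subseteq> F \<and> nbhd E H \<inter> ?D = nbhd E F \<inter> ?D"
  have "finite V" using G unfolding simple_graph_def by simp
  then have finF: "finite F" using U F(1) finite_subset by metis
  obtain H where H: "?P H" and min: "\<And>H'. ?P H' \<Longrightarrow> card H \<le> card H'"
    using ex_has_least_nat[of ?P F card] by auto
  have finH: "finite H" using H finF finite_subset by blast
  \<comment> \<open>Without a private neighbour \<open>u\<close> could be dropped without changing
    the trace, against minimality.\<close>
  have "\<exists>w. w \<in> ?D \<and> {u, w} \<in> E \<and> (\<forall>v\<in>H - {u}. {v, w} \<notin> E)" if u: "u \<in> H" for u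
  proof (rule ccontr)
    assume c: "\<not> ?thesis"
    have "nbhd E H \<inter> ?D = nbhd E (H - {u}) \<inter> ?D"
      using c unfolding nbhd_def by blast
    then have "?P (H - {u})" using H by auto
    from min[OF this] have "card H \<le> card (H - {u})" .
    then show False using u finH by (meson card_Diff1_less not_le)
  qed
  then obtain w where w: "\<And>u. u \<in> H \<Longrightarrow> w u \<in> ?D" "\<And>u. u \<in> H \<Longrightarrow> {u, w u} \<in> E"
    "\<And>u v. u \<in> H \<Longrightarrow> v \<in> H \<Longrightarrow> {v, w u} \<in> E \<Longrightarrow> v = u"
    by (metis Diff_iff singletonD)
  have HU: "H \<subseteq> U" and HF: "H \<subseteq> F" using H F(1) by auto
  have w_inj: "w u = w v \<Longrightarrow> u = v" if "u \<in> H" "v \<in> H" for u v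
    using w(2)[OF that(1)] w(3)[OF that(2,1)] by simp
  have w_ne: "w u \<noteq> v" if "u \<in> H" "v \<in> H" for u v
    using w(1)[OF that(1)] HU that by blast
  define M where "M = (\<lambda>u. {u, w u}) ` H"
  have "inj_on (\<lambda>u. {u, w u}) H"
    by (rule inj_onI) (use w_ne in \<open>auto simp: doubleton_eq_iff\<close>)
  then have cardM: "card M = card H" unfolding M_def by (rule card_image)
  have "induced_matching (upper_edges V E U) U ?D M"
    unfolding induced_matching_def
  proof (intro conjI)
    have up: "{u, w u} \<in> upper_edges V E U" if "u \<in> H" for u
      using w(2)[OF that] HU that unfolding upper_edges_def by blast
    show Msub: "M \<subseteq> upper_edges V E U" unfolding M_def using up by blast
    show "pairwise disjnt M"
    proof (rule pairwiseI)
      fix e f assume ef: "e \<in> M" "f \<in> M" "e \<noteq> f"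
      then obtain u v where uv: "u \<in> H" "v \<in> H" "e = {u, w u}" "f = {v, w v}" "u \<noteq> v"
        unfolding M_def by blast
      have "w u \<noteq> w v" using w_inj uv by blast
      then show "disjnt e f" using w_ne[of u v] w_ne[of v u] uv by (auto simp: disjnt_iff)
    qed
    show "\<forall>e\<in>M. \<exists>u\<in>U. \<exists>w\<in>?D. e = {u, w}" unfolding M_def using w(1) HU by blast
    \<comment> \<open>A surviving edge has an end \<open>x\<close> in \<open>U\<close>, which is in
      \<open>H\<close> because all \<open>w u\<close> are outside \<open>U\<close>. By independence
      the other end is some \<open>w u\<close>, and privacy gives \<open>x = u\<close>.\<close>
    have "e \<in> M" if e: "e \<in> upper_edges V E U" "e \<subseteq> \<Union>M" for e
    proof -
      have eE: "e \<in> E" and eU: "\<not> e \<subseteq> ?D" using e unfolding upper_edges_def by auto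
      obtain a b where ab: "e = {a, b}" using simple_graph_edge_cases[OF G eE] by blast
      have abV: "a \<in> V" "b \<in> V" using simple_graph_edge[OF G] eE ab by auto
      obtain x y where xy: "e = {x, y}" "x \<in> U"
        using ab abV eU by (cases "a \<in> U") (auto simp: insert_commute)
      have xM: "x \<in> \<Union>M" and yM: "y \<in> \<Union>M" using e(2) xy by auto
      have x: "x \<in> H" using xM w(1) xy(2) unfolding M_def by auto
      have "y \<notin> H"
        using F(2) HF x eE xy unfolding indep_def by blast
      then obtain u where u: "u \<in> H" "y = w u" using yM unfolding M_def by blast
      then have "x = u" using w(3)[OF u(1) x] eE xy by simp
      then show ?thesis unfolding M_def using u xy by blast
    qed
    then show "{e \<in> upper_edges V E U. e \<subseteq> \<Union>M} = M" using Msub by blast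
  qed
  then have "card H \<le> cut_width V E U" using card_le_cut_width[OF G] cardM by metis
  then show ?thesis using that H by blast
qed

text \<open>A nonempty set of at most \<open>r\<close> elements is the range of a word of length
  exactly \<open>r\<close>, obtained by padding with copies of one element. The summand 1 accounts
  for the empty set.\<close>

lemma card_subsets_le:
  assumes "finite V"
  shows "card {F. F \<subseteq> V \<and> card F \<le> r} \<le> card V ^ r + 1"
proof -
  have "{F. F \<subseteq> V \<and> card F \<le> r} \<subseteq> insert {} (set ` {xs. set xs \<subseteq> V \<and> length xs = r})"
  proof
    fix F assume F: "F \<in> {F. F \<subseteq> V \<and> card F \<le> r}"
    show "F \<in> insert {} (set ` {xs. set xs \<subseteq> V \<and> length xs = r})"
    proof (cases "F = {}")
      case False
      then obtain x where x: "x \<in> F" by blast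
      have "finite F" using F assms finite_subset by blast
      then obtain ys where ys: "set ys = F" "length ys = card F" by (metis finite_list distinct_card finite_distinct_list)
      have "set (ys @ replicate (r - card F) x) = F" using ys x by auto
      moreover have "length (ys @ replicate (r - card F) x) = r" using ys F by simp
      ultimately have "F \<in> set ` {xs. set xs \<subseteq> V \<and> length xs = r}" using F by blast
      then show ?thesis by simp
    qed simp
  qed
  moreover have fin: "finite {xs. set xs \<subseteq> V \<and> length xs = r}"
    by (rule finite_lists_length_eq[OF assms])
  ultimately have "card {F. F \<subseteq> V \<and> card F \<le> r} \<le>
      card (insert {} (set ` {xs. set xs \<subseteq> V \<and> length xs = r}))"
    by (intro card_mono) auto
  also have "\<dots> \<le> Suc (card (set ` {xs. set xs \<subseteq> V \<and> length xs = r}))" by (simp add: card_insert_if fin)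
  also have "\<dots> \<le> Suc (card {xs. set xs \<subseteq> V \<and> length xs = r})"
    using card_image_le[OF fin] by simp
  finally show ?thesis using card_lists_length_eq[OF assms] by simp
qed

section \<open>The OBDD of forced sets along a fixed order\<close>

locale ordered_graph =
  fixes V :: "'a set" and E :: "'a set set" and \<pi> :: "'a list"
  assumes G: "simple_graph V E" and dist: "distinct \<pi>" and set_\<pi>: "set \<pi> = V"
begin

abbreviation "n \<equiv> length \<pi>"
abbreviation "U i \<equiv> set (take i \<pi>)"
abbreviation "D i \<equiv> set (drop i \<pi>)"

lemma D_eq: "D i = V - U i"
proof -
  have "U i \<inter> D i = {}" by (rule set_take_disj_set_drop_if_distinct[OF dist order_refl])
  moreover have "U i \<union> D i = V" using set_append[of "take i \<pi>" "drop i \<pi>"] set_\<pi> by simp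
  ultimately show ?thesis by blast
qed

lemma U_Suc: "i < n \<Longrightarrow> U (Suc i) = insert (\<pi> ! i) (U i)"
  by (simp add: take_Suc_conv_app_nth)

lemma D_Suc: "i < n \<Longrightarrow> D i = insert (\<pi> ! i) (D (Suc i))"
  by (simp flip: Cons_nth_drop_Suc)

lemma nth_notin_D_Suc: "i < n \<Longrightarrow> \<pi> ! i \<notin> D (Suc i)"
  unfolding D_eq by (simp add: U_Suc)

text \<open>\<open>F\<close> plays the false vertices among those read. Independence says that no
  edge is violated yet; violated situations are all represented by the false sink.\<close>

definition states :: "nat \<Rightarrow> 'a set set" where
  "states i = {nbhd E F \<inter> D i | F. F \<subseteq> U i \<and> indep E F}"

definition pos_succ :: "nat \<Rightarrow> 'a set \<Rightarrow> (nat \<times> 'a set) option" where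
  "pos_succ i T = Some (Suc i, T - {\<pi> ! i})"

text \<open>A forced vertex read as false leaves an edge to an earlier false vertex uncovered, hence
  \<open>None\<close>; otherwise its unread neighbours become forced.\<close>

definition neg_succ :: "nat \<Rightarrow> 'a set \<Rightarrow> (nat \<times> 'a set) option" where
  "neg_succ i T = (if \<pi> ! i \<in> T then None
     else Some (Suc i, (T \<union> nbhd E {\<pi> ! i}) \<inter> D (Suc i)))"

text \<open>The node \<open>Some (i, T)\<close> is reached after reading \<open>i\<close> variables; \<open>T\<close> is the set of unread
  variables that the false ones among those read force to be true. \<open>None\<close> is the false sink.\<close>

definition graph_obdd :: "((nat \<times> 'a set) option, 'a) bdd" where
  "graph_obdd = \<lparr>
     nodes = insert None {Some (i, T) | i T. i \<le> n \<and> T \<in> states i},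
     edges = {(Some (i, T), l, q) | i T l q. i < n \<and> T \<in> states i \<and>
       (l = Pos (\<pi> ! i) \<and> q = pos_succ i T \<or> l = Neg (\<pi> ! i) \<and> q = neg_succ i T)},
     label = (\<lambda>p. \<pi> ! fst (the p)),
     true_sink = Some (n, {}),
     false_sink = None\<rparr>"

lemma graph_obdd_simps [simp]:
  "None \<in> nodes graph_obdd"
  "Some (i, T) \<in> nodes graph_obdd \<longleftrightarrow> i \<le> n \<and> T \<in> states i"
  "(None, l, q) \<notin> edges graph_obdd"
  "(Some (i, T), l, q) \<in> edges graph_obdd \<longleftrightarrow> i < n \<and> T \<in> states i \<and>
     (l = Pos (\<pi> ! i) \<and> q = pos_succ i T \<or> l = Neg (\<pi> ! i) \<and> q = neg_succ i T)"
  "label graph_obdd (Some (i, T)) = \<pi> ! i"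
  "true_sink graph_obdd = Some (n, {})"
  "false_sink graph_obdd = None"
  by (auto simp: graph_obdd_def)

lemma empty_in_states: "{} \<in> states i"
  unfolding states_def by (rule CollectI, rule exI[of _ "{}"]) (simp add: nbhd_def indep_def)

lemma states_0: "states 0 = {{}}"
proof -
  have "states 0 \<subseteq> {{}}" unfolding states_def by (auto simp: nbhd_def)
  then show ?thesis using empty_in_states by blast
qed

lemma states_n: "states n = {{}}"
  using empty_in_states[of n] unfolding states_def by auto

lemma statesD: "T \<in> states i \<Longrightarrow> T \<subseteq> D i"
  unfolding states_def by auto

text \<open>With \<open>neg_succ_trace\<close>: the transitions on traces mirror keeping
  \<open>F\<close> or adding the vertex just read. So the trace alone, whatever \<open>F\<close>
  produced it, determines the future.\<close>

lemma pos_succ_trace: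
  "i < n \<Longrightarrow> pos_succ i (nbhd E F \<inter> D i) = Some (Suc i, nbhd E F \<inter> D (Suc i))"
  unfolding pos_succ_def using nth_notin_D_Suc by (auto simp: D_Suc)

lemma neg_succ_trace:
  assumes "i < n" "\<pi> ! i \<notin> nbhd E F"
  shows "neg_succ i (nbhd E F \<inter> D i) = Some (Suc i, nbhd E (insert (\<pi> ! i) F) \<inter> D (Suc i))"
proof -
  have "(nbhd E F \<inter> D i \<union> nbhd E {\<pi> ! i}) \<inter> D (Suc i) = nbhd E (insert (\<pi> ! i) F) \<inter> D (Suc i)"
    unfolding D_Suc[OF assms(1)] nbhd_def by blast
  then show ?thesis unfolding neg_succ_def using assms by simp
qed

lemma indep_insert:
  assumes "indep E F" "v \<notin> nbhd E F"
  shows "indep E (insert v F)"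
proof -
  have "{v} \<notin> E" using simple_graph_edge(3)[OF G, of v v] by auto
  then show ?thesis using assms unfolding indep_def nbhd_def by (auto simp: insert_commute)
qed

lemma graph_obdd_edge_nodes:
  assumes "(p, l, q) \<in> edges graph_obdd"
  shows "p \<in> nodes graph_obdd \<and> q \<in> nodes graph_obdd"
proof -
  obtain i T where p: "p = Some (i, T)" using assms by (cases p) auto
  have i: "i < n" and T: "T \<in> states i" and q: "q = pos_succ i T \<or> q = neg_succ i T"
    using assms unfolding p by auto
  obtain F where F: "T = nbhd E F \<inter> D i" "F \<subseteq> U i" "indep E F"
    using T unfolding states_def by blast
  have "q \<in> nodes graph_obdd"
  proof (cases "q = pos_succ i T")
    case True
    have "nbhd E F \<inter> D (Suc i) \<in> states (Suc i)"
      using F U_Suc[OF i] unfolding states_def by blast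
    then show ?thesis using i True pos_succ_trace[OF i] F(1) by simp
  next
    case False
    then have q: "q = neg_succ i T" using q by simp
    show ?thesis
    proof (cases "\<pi> ! i \<in> nbhd E F")
      case True
      then show ?thesis using F(1) D_Suc[OF i] q by (simp add: neg_succ_def)
    next
      case False
      have "insert (\<pi> ! i) F \<subseteq> U (Suc i)" using F U_Suc[OF i] by blast
      then have "nbhd E (insert (\<pi> ! i) F) \<inter> D (Suc i) \<in> states (Suc i)"
        using indep_insert[OF F(3) False] unfolding states_def by blast
      then show ?thesis using i q neg_succ_trace[OF i False] F(1) by simp
    qed
  qed
  then show ?thesis using p i T by simp
qed

text \<open>States are defined by independent sets and not by reachability, so uniqueness of the
  source needs this. Removing \<open>\<pi> ! i\<close> from the set \<open>F\<close> behind
  \<open>T'\<close> gives a preceding state.\<close>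

lemma graph_obdd_pred:
  assumes i: "i < n" and T': "T' \<in> states (Suc i)"
  shows "\<exists>p l. (p, l, Some (Suc i, T')) \<in> edges graph_obdd"
proof -
  obtain F where F: "T' = nbhd E F \<inter> D (Suc i)" "F \<subseteq> U (Suc i)" "indep E F"
    using T' unfolding states_def by blast
  let ?H = "F - {\<pi> ! i}"
  have H: "?H \<subseteq> U i" "indep E ?H" using F U_Suc[OF i] unfolding indep_def by auto
  then have st: "nbhd E ?H \<inter> D i \<in> states i" unfolding states_def by blast
  show ?thesis
  proof (cases "\<pi> ! i \<in> F")
    case True
    have "\<pi> ! i \<notin> nbhd E ?H" using F(3) True unfolding indep_def nbhd_def by blast
    from neg_succ_trace[OF i this] have "neg_succ i (nbhd E ?H \<inter> D i) = Some (Suc i, T')"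
      using True F(1) by (simp add: insert_absorb)
    then have "(Some (i, nbhd E ?H \<inter> D i), Neg (\<pi> ! i), Some (Suc i, T')) \<in> edges graph_obdd"
      using i st by simp
    then show ?thesis by blast
  next
    case False
    then have "pos_succ i (nbhd E ?H \<inter> D i) = Some (Suc i, T')"
      using pos_succ_trace[OF i, of F] F(1) by simp
    then have "(Some (i, nbhd E ?H \<inter> D i), Pos (\<pi> ! i), Some (Suc i, T')) \<in> edges graph_obdd"
      using i st by simp
    then show ?thesis by blast
  qed
qed

text \<open>Make false only the earlier end of the edge; reading its later end as false then leads
  to the false sink.\<close>

lemma graph_obdd_false_pred:
  assumes "{u, v} \<in> E"
  shows "\<exists>p l. (p, l, None) \<in> edges graph_obdd"
proof -
  have *: ?thesis if ij: "i < j" "j < n" "{\<pi> ! i, \<pi> ! j} \<in> E" for i j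
  proof -
    have "\<pi> ! i \<in> U j" using ij by (auto simp: in_set_conv_nth)
    moreover have "indep E {\<pi> ! i}"
      using simple_graph_edge(3)[OF G, of "\<pi> ! i" "\<pi> ! i"] unfolding indep_def by auto
    ultimately have "nbhd E {\<pi> ! i} \<inter> D j \<in> states j" unfolding states_def by blast
    moreover have "\<pi> ! j \<in> nbhd E {\<pi> ! i} \<inter> D j"
      using ij(3) D_Suc[OF ij(2)] unfolding nbhd_def by auto
    ultimately have "(Some (j, nbhd E {\<pi> ! i} \<inter> D j), Neg (\<pi> ! j), None) \<in> edges graph_obdd"
      using ij(2) by (simp add: neg_succ_def)
    then show ?thesis by blast
  qed
  have "u \<in> set \<pi>" "v \<in> set \<pi>" "u \<noteq> v" using simple_graph_edge[OF G assms] set_\<pi> by auto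
  then obtain i j where ij: "i < n" "j < n" "u = \<pi> ! i" "v = \<pi> ! j" "i \<noteq> j"
    by (metis in_set_conv_nth)
  show ?thesis
  proof (cases "i < j")
    case True then show ?thesis using * ij assms by blast
  next
    case False
    then have "j < i" using ij by simp
    then show ?thesis using *[of j i] ij assms by (simp add: insert_commute)
  qed
qed

text \<open>An edge of the graph guarantees that the false sink is entered and so is not a second
  source.\<close>

lemma graph_obdd_sources:
  assumes "E \<noteq> {}"
  shows "sources graph_obdd = {Some (0, {})}"
proof -
  obtain e where "e \<in> E" using assms by blast
  then obtain u v where "{u, v} \<in> E" using simple_graph_edge_cases[OF G] by metis
  note np = graph_obdd_false_pred[OF this]
  have "p = Some (0, {})" if p: "p \<in> sources graph_obdd" for p
  proof -
    have pn: "p \<in> nodes graph_obdd" and nopred: "\<nexists>q l. (q, l, p) \<in> edges graph_obdd"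
      using p unfolding sources_def by auto
    then obtain i T where iT: "p = Some (i, T)" using np by (cases p) auto
    have i: "i \<le> n" "T \<in> states i" using pn iT by auto
    show ?thesis
    proof (cases i)
      case 0
      then show ?thesis using i iT states_0 by simp
    next
      case (Suc k)
      then show ?thesis using graph_obdd_pred[of k T] nopred iT i by simp
    qed
  qed
  \<comment> \<open>Successors have level \<open>Suc i\<close> or are \<open>None\<close>, so level
    0 is never entered.\<close>
  moreover have "(q, l, Some (0, {})) \<notin> edges graph_obdd" for q l
    by (cases q) (auto simp: pos_succ_def neg_succ_def split: if_splits)
  then have "Some (0, {}) \<in> sources graph_obdd"
    unfolding sources_def using states_0 by simp
  ultimately show ?thesis by blast
qed

lemma graph_obdd_out:
  "i < n \<Longrightarrow> T \<in> states i \<Longrightarrow> {(l, q). (Some (i, T), l, q) \<in> edges graph_obdd} =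
     {(Pos (\<pi> ! i), pos_succ i T), (Neg (\<pi> ! i), neg_succ i T)}"
  by auto

lemma graph_obdd_sinks: "sinks graph_obdd = {Some (n, {}), None}"
proof -
  have "p = Some (n, {}) \<or> p = None" if "p \<in> sinks graph_obdd" for p
  proof (cases p)
    case (Some iT)
    obtain i T where iT: "p = Some (i, T)" using Some by (cases iT) auto
    have "i \<le> n" "T \<in> states i" "\<not> i < n"
      using that unfolding sinks_def iT by auto
    then show ?thesis using iT states_n by auto
  qed simp
  moreover have "Some (n, {}) \<in> sinks graph_obdd" "None \<in> sinks graph_obdd"
    unfolding sinks_def using empty_in_states by auto
  ultimately show ?thesis by blast
qed

lemma graph_obdd_nodes: "nodes graph_obdd = insert None (Some ` Sigma {..n} states)"
  unfolding graph_obdd_def by auto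

lemma finite_states: "finite (states i)"
proof -
  have "states i \<subseteq> Pow (D i)" using statesD by blast
  then show ?thesis by (rule finite_subset) simp
qed

lemma is_obdd_graph_obdd:
  assumes "E \<noteq> {}"
  shows "is_obdd V graph_obdd"
\<comment> \<open>The false sink gets level \<open>Suc n\<close>, above every node from which it is
  entered.\<close>
proof (rule is_obdd_by_level[OF _ _ _ _ _ _ dist set_\<pi>, where lev = "\<lambda>p. case p of None \<Rightarrow> Suc n | Some (i, T) \<Rightarrow> i"])
  show "finite (nodes graph_obdd)" unfolding graph_obdd_nodes using finite_states by simp
  show "edges graph_obdd \<subseteq> nodes graph_obdd \<times> UNIV \<times> nodes graph_obdd"
    using graph_obdd_edge_nodes by auto
  show "card (sources graph_obdd) = 1" unfolding graph_obdd_sources[OF assms] by simp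
  show "sinks graph_obdd = {true_sink graph_obdd, false_sink graph_obdd}"
    using graph_obdd_sinks by simp
  fix p assume p: "p \<in> nodes graph_obdd - sinks graph_obdd"
  then have "p \<noteq> None" using graph_obdd_sinks by auto
  then obtain i T where iT: "p = Some (i, T)" by (cases p) auto
  have "i \<le> n" "T \<in> states i" using p iT by auto
  moreover have "i \<noteq> n" using p graph_obdd_sinks states_n iT by auto
  ultimately show "\<exists>q1 q0. {(l, q). (p, l, q) \<in> edges graph_obdd} =
      {(Pos (label graph_obdd p), q1), (Neg (label graph_obdd p), q0)}"
    using graph_obdd_out[of i T] iT by auto
next
  fix p l q assume pq: "(p, l, q) \<in> edges graph_obdd"
  then obtain i T where iT: "p = Some (i, T)" by (cases p) auto
  show "(case p of None \<Rightarrow> Suc n | Some (i, T) \<Rightarrow> i) < (case q of None \<Rightarrow> Suc n | Some (i, T) \<Rightarrow> i) \<and>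
      (case p of None \<Rightarrow> Suc n | Some (i, T) \<Rightarrow> i) < n \<and>
      label graph_obdd p = \<pi> ! (case p of None \<Rightarrow> Suc n | Some (i, T) \<Rightarrow> i)"
    using pq unfolding iT by (auto simp: pos_succ_def neg_succ_def)
qed simp

text \<open>For a cover \<open>P\<close> the false read vertices \<open>U i - P\<close> are
  independent and no false vertex is ever forced, so the run follows their traces to the true sink.
  The path is built backwards from level \<open>n\<close>.\<close>

lemma graph_obdd_complete:
  assumes cov: "\<And>u v. {u, v} \<in> E \<Longrightarrow> u \<in> P \<or> v \<in> P" and i: "i \<le> n"
  shows "\<exists>es. bdd_path graph_obdd (Some (i, nbhd E (U i - P) \<inter> D i)) es (Some (n, {})) \<and>
    reads_in (asg V P) es"
  using i
proof (induction i rule: inc_induct)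
  case base
  show ?case by (rule exI[of _ "[]"]) (simp add: empty_in_states)
next
  case (step i)
  let ?T = "\<lambda>i. nbhd E (U i - P) \<inter> D i"
  obtain es where es: "bdd_path graph_obdd (Some (Suc i, ?T (Suc i))) es (Some (n, {}))"
    "reads_in (asg V P) es" using step.IH by blast
  have i: "i < n" using step.hyps by simp
  have "indep E (U i - P)" using cov unfolding indep_def by blast
  then have st: "?T i \<in> states i" unfolding states_def by blast
  have nV: "\<pi> ! i \<in> V" using i set_\<pi> nth_mem by blast
  show ?case
  proof (cases "\<pi> ! i \<in> P")
    case True
    then have "U (Suc i) - P = U i - P" using U_Suc[OF i] by auto
    then have "pos_succ i (?T i) = Some (Suc i, ?T (Suc i))" using pos_succ_trace[OF i] by simp
    then show ?thesis
      using es i st nV True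
      by (intro exI[of _ "(Some (i, ?T i), Pos (\<pi> ! i), Some (Suc i, ?T (Suc i))) # es"]) simp
  next
    case False
    then have "U (Suc i) - P = insert (\<pi> ! i) (U i - P)" using U_Suc[OF i] by auto
    moreover have "\<pi> ! i \<notin> nbhd E (U i - P)" using cov False unfolding nbhd_def by blast
    ultimately have "neg_succ i (?T i) = Some (Suc i, ?T (Suc i))" using neg_succ_trace[OF i] by simp
    then show ?thesis
      using es i st nV False
      by (intro exI[of _ "(Some (i, ?T i), Neg (\<pi> ! i), Some (Suc i, ?T (Suc i))) # es"]) simp
  qed
qed

text \<open>The invariant for an arbitrary node: the remaining path certifies that all forced
  vertices are true and all edges between unread vertices are covered. At the source this is the
  full cover condition.\<close>

lemma graph_obdd_sound:
  assumes "bdd_path graph_obdd (Some (i, T)) es (Some (n, {}))" "reads_in (asg V P) es"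
  shows "T \<subseteq> P \<and> (\<forall>u\<in>D i. \<forall>v\<in>D i. {u, v} \<in> E \<longrightarrow> u \<in> P \<or> v \<in> P)"
  using assms
proof (induction es arbitrary: i T)
  case (Cons e es)
  obtain l b where e: "e = (Some (i, T), l, b)" and ed: "(Some (i, T), l, b) \<in> edges graph_obdd"
    "bdd_path graph_obdd b es (Some (n, {}))" "l \<in> asg V P" "reads_in (asg V P) es"
    using Cons.prems by (cases e) auto
  have i: "i < n" and T: "T \<in> states i" using ed(1) by auto
  have TD: "T \<subseteq> insert (\<pi> ! i) (D (Suc i))" using statesD[OF T] D_Suc[OF i] by simp
  \<comment> \<open>No edge leaves the false sink, so no path leads from it to the true
    sink.\<close>
  have bn: "b \<noteq> None"
  proof
    assume "b = None"
    then show False using ed(2) by (cases es) auto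
  qed
  have noloop: "{\<pi> ! i} \<notin> E" using simple_graph_edge(3)[OF G, of "\<pi> ! i" "\<pi> ! i"] by auto
  from ed(1) consider "l = Pos (\<pi> ! i)" "b = pos_succ i T" | "l = Neg (\<pi> ! i)" "b = neg_succ i T"
    by auto
  then show ?case
  proof cases
    case 1
    have "\<pi> ! i \<in> P" using 1 ed(3) by simp
    moreover have "T - {\<pi> ! i} \<subseteq> P \<and> (\<forall>u\<in>D (Suc i). \<forall>v\<in>D (Suc i). {u, v} \<in> E \<longrightarrow> u \<in> P \<or> v \<in> P)"
      by (rule Cons.IH[OF _ ed(4)]) (use ed(2) 1 in \<open>simp add: pos_succ_def\<close>)
    ultimately show ?thesis unfolding D_Suc[OF i] by blast
  next
    case 2
    have nP: "\<pi> ! i \<notin> P" using 2 ed(3) by simp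
    have nT: "\<pi> ! i \<notin> T" using bn 2 by (auto simp: neg_succ_def)
    have IH: "(T \<union> nbhd E {\<pi> ! i}) \<inter> D (Suc i) \<subseteq> P \<and>
        (\<forall>u\<in>D (Suc i). \<forall>v\<in>D (Suc i). {u, v} \<in> E \<longrightarrow> u \<in> P \<or> v \<in> P)"
      by (rule Cons.IH[OF _ ed(4)]) (use ed(2) 2 nT in \<open>simp add: neg_succ_def\<close>)
    \<comment> \<open>Edges between the vertex just made false and later ones are handled by the
      forced set of the successor.\<close>
    have "v \<in> P" if "v \<in> D (Suc i)" "{\<pi> ! i, v} \<in> E" for v
      using that IH unfolding nbhd_def by blast
    then have "\<forall>u\<in>D i. \<forall>v\<in>D i. {u, v} \<in> E \<longrightarrow> u \<in> P \<or> v \<in> P"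
      using IH noloop unfolding D_Suc[OF i] by (auto simp: insert_commute)
    moreover have "T \<subseteq> P" using TD nT IH by blast
    ultimately show ?thesis by blast
  qed
qed simp

lemma represents_graph_obdd:
  assumes "E \<noteq> {}"
  shows "represents V graph_obdd (graph_cnf E)"
  unfolding represents_def
proof
  fix S assume "S \<in> total_assignments V"
  then obtain P where S: "S = asg V P" using total_assignments_asg by blast
  have acc: "accepts graph_obdd S \<longleftrightarrow>
      (\<exists>es. bdd_path graph_obdd (Some (0, {})) es (Some (n, {})) \<and> reads_in (asg V P) es)"
    unfolding accepts_reads_in graph_obdd_sources[OF assms] S by simp
  have "nbhd E (U 0 - P) \<inter> D 0 = {}" by (simp add: nbhd_def)
  then have "(\<forall>u v. {u, v} \<in> E \<longrightarrow> u \<in> P \<or> v \<in> P) \<Longrightarrow> accepts graph_obdd S"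
    unfolding acc using graph_obdd_complete[of P 0] by simp
  moreover have "\<forall>u v. {u, v} \<in> E \<longrightarrow> u \<in> P \<or> v \<in> P" if "accepts graph_obdd S"
    using that graph_obdd_sound[of 0 "{}" _ P] simple_graph_edge[OF G] set_\<pi>
    unfolding acc by fastforce
  ultimately show "accepts graph_obdd S \<longleftrightarrow> satisfies S (graph_cnf E)"
    unfolding S satisfies_asg_graph_cnf[OF G] by blast
qed

section \<open>Size of the constructed OBDD\<close>

lemma card_states_le:
  assumes "i \<le> n"
  shows "card (states i) \<le> card V ^ perm_width V E \<pi> + 1"
proof -
  let ?r = "perm_width V E \<pi>"
  have finV: "finite V" using G unfolding simple_graph_def by simp
  have UV: "U i \<subseteq> V" using set_\<pi> set_take_subset[of i \<pi>] by simp
  have "states i \<subseteq> (\<lambda>F. nbhd E F \<inter> D i) ` {F. F \<subseteq> V \<and> card F \<le> ?r}"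
  proof
    fix T assume "T \<in> states i"
    then obtain F where F: "T = nbhd E F \<inter> D i" "F \<subseteq> U i" "indep E F" unfolding states_def by blast
    obtain H where H: "H \<subseteq> F" "nbhd E H \<inter> D i = nbhd E F \<inter> D i" "card H \<le> cut_width V E (U i)"
      using small_set_same_trace[OF G UV F(2,3)] unfolding D_eq by metis
    have "card H \<le> ?r"
    \<comment> \<open>\<open>perm_width\<close> takes no account of the cut at 0; there
      \<open>F\<close>, and with it \<open>H\<close>, is empty.\<close>
    proof (cases "i = 0")
      case True
      then show ?thesis using H(1) F(2) by simp
    next
      case False
      then have "cut_width V E (U i) \<le> ?r"
        unfolding perm_width_def using assms by (intro Max_ge) auto
      then show ?thesis using H(3) by simp
    qed
    then show "T \<in> (\<lambda>F. nbhd E F \<inter> D i) ` {F. F \<subseteq> V \<and> card F \<le> ?r}"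
      using F H UV by blast
  qed
  moreover have fin: "finite {F. F \<subseteq> V \<and> card F \<le> ?r}" using finV by simp
  ultimately have "card (states i) \<le> card ((\<lambda>F. nbhd E F \<inter> D i) ` {F. F \<subseteq> V \<and> card F \<le> ?r})"
    by (intro card_mono) auto
  also have "\<dots> \<le> card {F. F \<subseteq> V \<and> card F \<le> ?r}" by (rule card_image_le[OF fin])
  also have "\<dots> \<le> card V ^ ?r + 1" by (rule card_subsets_le[OF finV])
  finally show ?thesis .
qed

text \<open>One node for the false sink, and \<open>n + 1\<close> levels since both 0 and
  \<open>n\<close> occur.\<close>

lemma card_nodes_graph_obdd:
  "card (nodes graph_obdd) \<le> 1 + (card V + 1) * (card V ^ perm_width V E \<pi> + 1)"
proof -
  have n: "n = card V" using distinct_card[OF dist] set_\<pi> by simp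
  have "card (nodes graph_obdd) = Suc (card (Sigma {..n} states))"
    unfolding graph_obdd_nodes using finite_states by (simp add: card_image)
  also have "card (Sigma {..n} states) = (\<Sum>i\<le>n. card (states i))"
    using finite_states by simp
  also have "\<dots> \<le> (\<Sum>i\<le>n. card V ^ perm_width V E \<pi> + 1)"
    by (rule sum_mono) (use card_states_le in simp)
  finally show ?thesis by (simp add: n)
qed

end

text \<open>Needed to absorb the polynomial factors into a multiple of \<open>lu V E\<close> in the
  exponent. In any order, a single edge is an induced matching across the cut just after its earlier
  end.\<close>

lemma lu_pos:
  assumes G: "simple_graph V E" and e: "E \<noteq> {}"
  shows "1 \<le> lu V E"
proof -
  have "finite V" using G unfolding simple_graph_def by simp
  then obtain \<pi> where \<pi>: "distinct \<pi>" "set \<pi> = V" "perm_width V E \<pi> = lu V E" by (rule lu_attained)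
  interpret ordered_graph V E \<pi> using G \<pi> by unfold_locales
  obtain u v where uv: "{u, v} \<in> E" using e simple_graph_edge_cases[OF G] by (metis all_not_in_conv)
  have *: "1 \<le> perm_width V E \<pi>" if ij: "i < j" "j < n" "{\<pi> ! i, \<pi> ! j} \<in> E" for i j
  proof -
    have i: "i < n" using ij by simp
    let ?W = "U (Suc i)"
    have "\<pi> ! i \<in> ?W" using U_Suc[OF i] by simp
    moreover have "D j \<subseteq> D (Suc i)" using ij(1) set_drop_subset_set_drop[of "Suc i" j \<pi>] by simp
    then have "\<pi> ! j \<in> V - ?W" using D_Suc[OF ij(2)] D_eq by blast
    ultimately have "induced_matching (upper_edges V E ?W) ?W (V - ?W) {{\<pi> ! i, \<pi> ! j}}"
    proof -
      assume a: "\<pi> ! i \<in> ?W" "\<pi> ! j \<in> V - ?W"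
      have "f = {\<pi> ! i, \<pi> ! j}" if f: "f \<in> E" "f \<subseteq> {\<pi> ! i, \<pi> ! j}" for f
      proof -
        have "card f = 2" using f(1) G unfolding simple_graph_def by blast
        moreover have "card {\<pi> ! i, \<pi> ! j} = 2" using ij(3) G unfolding simple_graph_def by blast
        ultimately show ?thesis using card_subset_eq[OF _ f(2)] by simp
      qed
      then show ?thesis
        using a ij(3) unfolding induced_matching_def upper_edges_def by (auto simp: pairwise_def)
    qed
    from card_le_cut_width[OF G this] have "1 \<le> cut_width V E ?W" by simp
    also have "\<dots> \<le> perm_width V E \<pi>"
      unfolding perm_width_def using i by (intro Max_ge) auto
    finally show ?thesis .
  qed
  have "u \<in> set \<pi>" "v \<in> set \<pi>" "u \<noteq> v" using simple_graph_edge[OF G uv] set_\<pi> by auto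
  then obtain i j where ij: "i < n" "j < n" "u = \<pi> ! i" "v = \<pi> ! j" "i \<noteq> j"
    by (metis in_set_conv_nth)
  then have "1 \<le> perm_width V E \<pi>"
    using *[of i j] *[of j i] uv by (cases "i < j") (simp_all add: insert_commute)
  then show ?thesis using \<pi>(3) by simp
qed

text \<open>Each of the three increments by 1 costs a factor \<open>m\<close>, and \<open>m\<close>
  itself is a fourth, giving exponent \<open>4 + r\<close>; this is at most \<open>5 * r\<close> as
  \<open>r \<ge> 1\<close>.\<close>

lemma obdd_size_bound:
  fixes m r :: nat
  assumes "2 \<le> m" "1 \<le> r"
  shows "1 + (m + 1) * (m ^ r + 1) \<le> m ^ (5 * r)"
proof -
  have inc: "1 + k \<le> m * k" if "1 \<le> k" for k :: nat
  proof -
    have "1 + k \<le> 2 * k" using that by simp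
    also have "\<dots> \<le> m * k" using assms(1) by simp
    finally show ?thesis .
  qed
  have "(m + 1) * (m ^ r + 1) \<le> (m * m) * (m * m ^ r)"
    by (rule mult_mono) (use inc[of m] inc[of "m ^ r"] assms in auto)
  then have "1 + (m + 1) * (m ^ r + 1) \<le> 1 + (m * m) * (m * m ^ r)" by simp
  also have "\<dots> \<le> m * ((m * m) * (m * m ^ r))" by (rule inc) (use assms in simp)
  also have "\<dots> = m ^ (4 + r)" by (simp add: power_add eval_nat_numeral)
  also have "\<dots> \<le> m ^ (5 * r)" by (rule power_increasing) (use assms in auto)
  finally show ?thesis .
qed

theorem theorem2:
  "\<exists>c::real. c > 0 \<and>
     (\<forall>(V :: 'a set) E.
        simple_graph V E \<longrightarrow> V \<noteq> {} \<longrightarrow> no_isolated V E \<longrightarrow>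
          2 ^ lu V E \<le> obdd V (graph_cnf E) \<and>
          real (obdd V (graph_cnf E)) \<le> real (card V) powr (c * real (lu V E)))"
\<comment> \<open>The constant 5 is the one of \<open>obdd_size_bound\<close>.\<close>
proof (intro exI[of _ "5::real"] conjI allI impI)
  fix V :: "'a set" and E
  assume G: "simple_graph V E" and V: "V \<noteq> {}" and iso: "no_isolated V E"
  have E: "E \<noteq> {}" using V iso unfolding no_isolated_def by blast
  have finV: "finite V" using G unfolding simple_graph_def by simp
  obtain \<pi> where \<pi>: "distinct \<pi>" "set \<pi> = V" "perm_width V E \<pi> = lu V E"
    by (rule lu_attained[OF finV])
  interpret ordered_graph V E \<pi> using G \<pi> by unfold_locales
  note Z = is_obdd_graph_obdd[OF E] represents_graph_obdd[OF E]
  show "2 ^ lu V E \<le> obdd V (graph_cnf E)"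
    \<comment> \<open>The constructed OBDD ensures that a smallest one exists, and the lower bound
      is applied to that one.\<close>
    by (rule obdd_attained[OF Z]) (metis obdd_size_lower_bound[OF G V])
  obtain e where e: "e \<in> E" using E by blast
  then have "e \<subseteq> V" "card e = 2" using G unfolding simple_graph_def by auto
  then have m: "2 \<le> card V" using card_mono[OF finV] by metis
  have "obdd V (graph_cnf E) \<le> card (nodes graph_obdd)" by (rule obdd_le[OF Z])
  also have "\<dots> \<le> card V ^ (5 * lu V E)"
    using card_nodes_graph_obdd obdd_size_bound[OF m lu_pos[OF G E]] \<pi>(3) by simp
  finally have "real (obdd V (graph_cnf E)) \<le> real (card V ^ (5 * lu V E))" by simp
  also have "\<dots> = real (card V) powr real (5 * lu V E)"
    using m by (subst powr_realpow) auto
  finally show "real (obdd V (graph_cnf E)) \<le> real (card V) powr (5 * real (lu V E))" by simp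
qed simp

end
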